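(* Let $q$ be a complex number with $0<|q|<1$, and for $\ell\in\{3,5,7\}$ let $\zeta_\ell$ denote a primitive $\ell$-th root of unity. Then the following five identities hold: \begin{align*} RU(\zeta_3,q) &= \frac{q^7}{(q^3;q^3)_\infty}\sum_{n=-\infty}^\infty \frac{(-1)^n q^{\frac{9n^2+27n}{2}}}{1-q^{9n+6}} - \frac{q^5}{(q^3;q^3)_\infty}\sum_{n=-\infty}^\infty \frac{(-1)^n q^{\frac{9n^2+21n}{2}}}{1-q^{9n+6}},\\ RV(\zeta_3,q) &= -\frac{q^3}{(q^3;q^3)_\infty}\sum_{n=-\infty}^\infty \frac{(-1)^n q^{\frac{9n^2+15n}{2}}}{1-q^{9n+6}} + \frac{q^5}{(q^3;q^3)_\infty}\sum_{n=-\infty}^\infty \frac{(-1)^n q^{\frac{9n^2+21n}{2}}}{1-q^{9n+6}},\\ RU(\zeta_5,q) &= q\frac{(q^{25};q^{25})_\infty}{[q^5;q^{25}]_\infty^2} - \frac{q^7}{(q^{25};q^{25})_\infty[q^{10};q^{25}]_\infty}\sum_{n=-\infty}^\infty \frac{(-1)^n q^{\frac{25n^2+45n}{2}}}{1-q^{25n+10}}\\ &\quad - \frac{q^4}{(q^{25};q^{25})_\infty[q^5;q^{25}]_\infty}\sum_{n=-\infty}^\infty \frac{(-1)^n q^{\frac{25n^2+35n}{2}}}{1-q^{25n+10}},\\ RV(\zeta_5,q) &= -\frac{q^5}{(q^{25};q^{25})_\infty[q^5;q^{25}]_\infty}\sum_{n=-\infty}^\infty \frac{(-1)^n q^{\frac{25n^2+35n}{2}}}{1-q^{25n+15}}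 + \frac{q^{12}}{(q^{25};q^{25})_\infty[q^{10};q^{25}]_\infty}\sum_{n=-\infty}^\infty \frac{(-1)^n q^{\frac{25n^2+55n}{2}}}{1-q^{25n+15}}\\ &\quad + q^2\frac{(q^{25};q^{25})_\infty}{[q^5,q^{10};q^{25}]_\infty} - q^3\frac{(q^{25};q^{25})_\infty}{[q^{10};q^{25}]_\infty^2},\\ RU(\zeta_7,q) &= q\frac{(q^{49};q^{49})_\infty[q^{21};q^{49}]_\infty}{[q^7;q^{49}]_\infty[q^{14};q^{49}]_\infty^2} - (\zeta_7^2+\zeta_7^5)\frac{q^{15}}{(q^{49};q^{49})_\infty[q^{21};q^{49}]_\infty}\sum_{n=-\infty}^\infty \frac{(-1)^n q^{\frac{49n^2+91n}{2}}}{1-q^{49n+21}}\\ &\quad - (\zeta_7^3+\zeta_7^4)q^2\frac{(q^{49};q^{49})_\infty}{[q^7,q^{14};q^{49}]_\infty} + q^3\frac{(q^{49};q^{49})_\infty}{[q^7,q^{21};q^{49}]_\infty} + (\zeta_7+\zeta_7^6)q^4\frac{(q^{49};q^{49})_\infty}{[q^{14};q^{49}]_\infty^2}\\ &\quad + (\zeta_7+\zeta_7^6)\frac{q^{11}}{(q^{49};q^{49})_\infty[q^{14};q^{49}]_\infty}\sum_{n=-\infty}^\infty \frac{(-1)^n q^{\frac{49n^2+77n}{2}}}{1-q^{49n+21}} + (1+\zeta_7^3+\zeta_7^4)q^6\frac{(q^{49};q^{49})_\infty}{[q^{21};q^{49}]_\infty^2}\\ &\quad - (1+\zeta_7^3+\zeta_7^4)\frac{q^6}{(q^{49};q^{49})_\infty[q^7;q^{49}]_\infty}\sum_{n=-\infty}^\infty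 \frac{(-1)^n q^{\frac{49n^2+63n}{2}}}{1-q^{49n+21}}. \end{align*}
   Context: Notation: $(z;q)_n=\prod_{j=0}^{n-1}(1-zq^j)$, $(z;q)_\infty=\prod_{j=0}^\infty(1-zq^j)$, $(z_1,\dots,z_k;q)_n=(z_1;q)_n\cdots(z_k;q)_n$ (also for $n=\infty$), $[z;q]_\infty=(z;q)_\infty(q/z;q)_\infty$, and $[z_1,\dots,z_k;q]_\infty=[z_1;q]_\infty\cdots[z_k;q]_\infty$. Define $$F(\rho_1,\rho_2,z;q)=\frac{(q;q)_\infty}{(z,z^{-1},\rho_1,\rho_2;q)_\infty}\sum_{n=1}^\infty\frac{(z,z^{-1},\rho_1,\rho_2;q)_n\left(\frac{q}{\rho_1\rho_2}\right)^n}{(q;q)_{2n}},$$ $$G(\rho_1,\rho_2,z;q)=\frac{(q;q)_\infty}{(z,z^{-1},\rho_1,\rho_2;q)_\infty}\sum_{n=1}^\infty\frac{(z,z^{-1},\rho_1,\rho_2;q)_n\left(\frac{q^2}{\rho_1\rho_2}\right)^n}{(q;q)_{2n}},$$ and $RU(z,q)=F(z^2,z^{-2},z;q)$, $RV(z,q)=G(z^2,z^{-2},z;q)$. Thus $$RU(z,q)=\frac{(q;q)_\infty}{(z,z^{-1},z^2,z^{-2};q)_\infty}\sum_{n=1}^\infty\frac{(z,z^{-1},z^2,z^{-2};q)_n\,q^n}{(q;q)_{2n}},$$ and $RV(z,q)$ is given by the same expression with $q^n$ in the numerator of the summand replaced by $q^{2n}$. *)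

theory Defs
  imports "HOL-Analysis.Analysis"
begin

definition qpoch :: "complex \<Rightarrow> complex \<Rightarrow> nat \<Rightarrow> complex" where
  "qpoch z q n = (\<Prod>j<n. 1 - z * q ^ j)"

definition qpoch_inf :: "complex \<Rightarrow> complex \<Rightarrow> complex" where
  "qpoch_inf z q = (\<Prod>j. 1 - z * q ^ j)"

text \<open>The multi-parameter symbols $(z_1,\dots,z_k;q)_n$, $(z_1,\dots,z_k;q)_\infty$ and
  $[z_1,\dots,z_k;q]_\infty$ take the list of parameters $z_1,\dots,z_k$.\<close>

definition qpochs :: "complex list \<Rightarrow> complex \<Rightarrow> nat \<Rightarrow> complex" where
  "qpochs zs q n = (\<Prod>z\<leftarrow>zs. qpoch z q n)"

definition qpochs_inf :: "complex list \<Rightarrow> complex \<Rightarrow> complex" where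
  "qpochs_inf zs q = (\<Prod>z\<leftarrow>zs. qpoch_inf z q)"

definition qtheta :: "complex list \<Rightarrow> complex \<Rightarrow> complex" where
  "qtheta zs q = (\<Prod>z\<leftarrow>zs. qpoch_inf z q * qpoch_inf (q / z) q)"

definition F :: "complex \<Rightarrow> complex \<Rightarrow> complex \<Rightarrow> complex \<Rightarrow> complex" where
  "F \<rho>\<^sub>1 \<rho>\<^sub>2 z q =
     qpoch_inf q q / qpochs_inf [z, inverse z, \<rho>\<^sub>1, \<rho>\<^sub>2] q *
     (\<Sum>\<^sub>\<infinity>n\<in>{1..}. qpochs [z, inverse z, \<rho>\<^sub>1, \<rho>\<^sub>2] q n * (q / (\<rho>\<^sub>1 * \<rho>\<^sub>2)) ^ n / qpoch q q (2 * n))"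

definition G :: "complex \<Rightarrow> complex \<Rightarrow> complex \<Rightarrow> complex \<Rightarrow> complex" where
  "G \<rho>\<^sub>1 \<rho>\<^sub>2 z q =
     qpoch_inf q q / qpochs_inf [z, inverse z, \<rho>\<^sub>1, \<rho>\<^sub>2] q *
     (\<Sum>\<^sub>\<infinity>n\<in>{1..}. qpochs [z, inverse z, \<rho>\<^sub>1, \<rho>\<^sub>2] q n * (q\<^sup>2 / (\<rho>\<^sub>1 * \<rho>\<^sub>2)) ^ n / qpoch q q (2 * n))"

definition RU :: "complex \<Rightarrow> complex \<Rightarrow> complex" where
  "RU z q = F (z\<^sup>2) (z powi (-2)) z q"

definition RV :: "complex \<Rightarrow> complex \<Rightarrow> complex" where
  "RV z q = G (z\<^sup>2) (z powi (-2)) z q"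

text \<open>The bilateral series
  $\sum_{n=-\infty}^\infty (-1)^n q^{(an^2+bn)/2} / (1-q^{an+c})$. The division by 2 is on
  integers and is exact whenever $a \equiv b$ modulo 2, in particular for $a$ and $b$ both odd.\<close>

definition bilat :: "int \<Rightarrow> int \<Rightarrow> int \<Rightarrow> complex \<Rightarrow> complex" where
  "bilat a b c q =
     (\<Sum>\<^sub>\<infinity>n::int. (-1) powi n * q powi ((a * n\<^sup>2 + b * n) div 2) / (1 - q powi (a * n + c)))"

definition primitive_root_of_unity :: "nat \<Rightarrow> complex \<Rightarrow> bool" where
  "primitive_root_of_unity l z \<longleftrightarrow> l > 0 \<and> z ^ l = 1 \<and> (\<forall>k. 0 < k \<and> k < l \<longrightarrow> z ^ k \<noteq> 1)"

end

theory Submission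
  imports Defs
begin

text \<open>
  Let \<open>e(s) = (-1)\<^sup>s q\<^bsup>s(s-1)/2\<^esup>\<close> and suppose \<open>\<rho>\<^sub>1 = \<rho>\<close>, \<open>\<rho>\<^sub>2 = 1/\<rho>\<close>, as is the case for \<open>RU\<close> and
  \<open>RV\<close>. The finite Jacobi triple product expands \<open>(\<rho>;q)\<^sub>n (1/\<rho>;q)\<^sub>n / (q;q)\<^sub>2\<^sub>n\<close> as a sum over \<open>s\<close> of
  multiples of \<open>1 / ((q;q)\<^sub>n\<^sub>-\<^sub>s (q;q)\<^sub>n\<^sub>+\<^sub>s)\<close>. The remaining sum over \<open>n\<close> telescopes, and one obtains
  (\<open>F_expansion\<close>)

  \<open>(1 + \<rho>) (\<rho>, 1/\<rho>, q; q)\<^sub>\<infinity> F = \<Sum>\<^sub>s e(s) (\<rho>\<^sup>-\<^sup>s + \<rho>\<^sup>s\<^sup>+\<^sup>1 - 1 - \<rho>) q\<^sup>s / ((1 - z q\<^sup>s) (1 - q\<^sup>s/z))\<close>.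

  For \<open>G\<close> the summand has one more factor \<open>q\<^sup>s\<close> (\<open>G_expansion\<close>).

  Now let \<open>z = \<zeta>\<close> be a primitive root of unity of odd order \<open>l = 2h - 1\<close> and \<open>\<rho> = \<zeta>\<^sup>2\<close>. The weight
  \<open>\<rho>\<^sup>-\<^sup>s + \<rho>\<^sup>s\<^sup>+\<^sup>1 - 1 - \<rho> = - (1 - \<rho>\<^sup>-\<^sup>s) (1 - \<rho>\<^sup>s\<^sup>+\<^sup>1)\<close> depends only on \<open>s\<close> modulo \<open>l\<close> and vanishes for
  \<open>s \<equiv> 0\<close> and \<open>s \<equiv> -1\<close>. The denominator \<open>(1 - \<zeta> q\<^sup>s) (1 - q\<^sup>s/\<zeta>)\<close> divides \<open>1 - q\<^sup>l\<^sup>s\<close>. Hence the right-hand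
  side is a linear combination of the Lambert series \<open>lambert b i\<close>, the sum of
  \<open>e(s) q\<^sup>i\<^sup>s / (1 - q\<^sup>l\<^sup>s)\<close> over the residue class of \<open>b\<close>, and the theta function on the left-hand side is a
  linear combination of \<open>theta c\<close>, the sum of \<open>e(s)\<close> over the class of \<open>c\<close> (\<open>RU_RV_dissection\<close>). The
  bilateral series in the claim are Lambert series of this kind (\<open>lambert_eq_bilat\<close>), and by the triple product
  the infinite products in the claim are built from the numbers \<open>theta c\<close> (\<open>theta_product\<close>).

  What is needed in addition is a linear relation between Lambert series with the same \<open>i\<close> and
  different \<open>b\<close>, none of them divisible by \<open>l\<close> (\<open>theta_lambert_exchange\<close>):

  \<open>theta (b + i) lambert b' i - theta (b' + i) lambert b i
    = \<kappa> theta (b' - b + h) theta (b + b' + i) / (theta (b + h) theta (b' + h))\<close>.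

  Its proof is elementary. Collected by the sum \<open>\<sigma>\<close> of the two summation indices, the left-hand side becomes
  \<open>\<Sum> e(\<sigma>) d(\<sigma>)\<close> over one residue class, and a reflection shows that \<open>d\<close> is constant there. The
  constant does not involve \<open>i\<close> and is found from the one value of \<open>i\<close> for which a Lambert series is itself an
  infinite product (\<open>kronecker_sum\<close>).

  For \<open>l = 3\<close> only one residue class contributes, and the formulas follow at once. For \<open>l = 5\<close> and
  \<open>l = 7\<close> the exchange relation reduces all Lambert series to those in the claim. What
  remains is an identity between rational functions of the numbers \<open>theta c\<close> with coefficients in the real
  subfield of the cyclotomic field. For \<open>l = 5\<close> it holds identically; for \<open>l = 7\<close> it holds modulo the
  equation \<open>x\<^sup>3 y + y\<^sup>3 w + w\<^sup>3 x = 0\<close> of the Klein quartic, which is a consequence of the exchange relation.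
\<close>

section \<open>Sums over arbitrary index sets\<close>

text \<open>Dominated convergence for sums over an arbitrary index set: by the Weierstrass test the finite
  partial sums converge uniformly in \<open>n\<close>, so the two limits may be interchanged.\<close>

lemma tendsto_infsum_dominated:
  fixes f :: "nat \<Rightarrow> 'a \<Rightarrow> 'b :: banach"
  assumes lim: "\<And>s. (\<lambda>n. f n s) \<longlonglongrightarrow> g s"
    and bound: "\<And>n s. norm (f n s) \<le> h s"
    and h: "h summable_on A"
  shows "(\<lambda>n. \<Sum>\<^sub>\<infinity>s\<in>A. f n s) \<longlonglongrightarrow> (\<Sum>\<^sub>\<infinity>s\<in>A. g s)"
proof (rule swap_uniform_limit')
  have gh: "norm (g s) \<le> h s" for s
    by (rule Lim_bounded[OF tendsto_norm[OF lim]]) (use bound in auto)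
  have "g summable_on A"
    by (rule abs_summable_summable, rule summable_on_comparison_test[OF h]) (use gh in auto)
  then show "(sum g \<longlongrightarrow> (\<Sum>\<^sub>\<infinity>s\<in>A. g s)) (finite_subsets_at_top A)"
    by (rule infsum_tendsto)
  show "uniform_limit UNIV (\<lambda>X n. \<Sum>s\<in>X. f n s) (\<lambda>n. \<Sum>\<^sub>\<infinity>s\<in>A. f n s) (finite_subsets_at_top A)"
    by (rule Weierstrass_m_test_general[OF _ h]) (use bound in auto)
  show "\<forall>\<^sub>F X in finite_subsets_at_top A. (\<lambda>n. \<Sum>s\<in>X. f n s) \<longlonglongrightarrow> sum g X"
    by (intro always_eventually allI tendsto_sum lim)
qed auto

lemma infsum_sum_swap:
  fixes f :: "'i \<Rightarrow> 'a \<Rightarrow> 'b :: {topological_ab_group_add, t2_space}"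
  assumes "finite I" and "\<And>i. i \<in> I \<Longrightarrow> f i summable_on A"
  shows "(\<Sum>i\<in>I. \<Sum>\<^sub>\<infinity>s\<in>A. f i s) = (\<Sum>\<^sub>\<infinity>s\<in>A. \<Sum>i\<in>I. f i s)"
proof -
  have "((\<lambda>s. \<Sum>i\<in>I. f i s) has_sum (\<Sum>i\<in>I. \<Sum>\<^sub>\<infinity>s\<in>A. f i s)) A"
    using assms by (induction I rule: finite_induct) (auto intro!: has_sum_add)
  then show ?thesis by (simp add: infsumI)
qed

lemma infsum_int_shift:
  fixes f :: "int \<Rightarrow> 'a :: {topological_comm_monoid_add, t2_space}"
  shows "(\<Sum>\<^sub>\<infinity>j. f (j + k)) = (\<Sum>\<^sub>\<infinity>j. f j)"
  by (rule infsum_reindex_bij_witness[of _ "\<lambda>j. j - k" "\<lambda>j. j + k"]) auto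

lemma infsum_int_minus:
  fixes f :: "int \<Rightarrow> 'a :: {topological_comm_monoid_add, t2_space}"
  shows "(\<Sum>\<^sub>\<infinity>j. f (- j)) = (\<Sum>\<^sub>\<infinity>j. f j)"
  by (rule infsum_reindex_bij_witness[of _ uminus uminus]) auto

lemma has_sum_minus:
  fixes f g :: "'a \<Rightarrow> 'b :: topological_ab_group_add"
  assumes "(f has_sum a) A" "(g has_sum b) A"
  shows "((\<lambda>x. f x - g x) has_sum (a - b)) A"
  using has_sum_add[OF assms(1), of "\<lambda>x. - g x" "- b"] assms(2) by (simp add: has_sum_uminus)

lemma summable_on_minus:
  fixes f g :: "'a \<Rightarrow> 'b :: topological_ab_group_add"
  assumes "f summable_on A" "g summable_on A"
  shows "(\<lambda>x. f x - g x) summable_on A"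
  using assms has_sum_minus unfolding summable_on_def by blast

lemma infsum_minus:
  fixes f g :: "'a \<Rightarrow> 'b :: {topological_ab_group_add, t2_space}"
  assumes "f summable_on A" "g summable_on A"
  shows "(\<Sum>\<^sub>\<infinity>x\<in>A. f x - g x) = (\<Sum>\<^sub>\<infinity>x\<in>A. f x) - (\<Sum>\<^sub>\<infinity>x\<in>A. g x)"
  using assms by (intro infsumI has_sum_minus) auto

lemma summable_bounded_times:
  fixes f :: "int \<Rightarrow> complex"
  assumes "f summable_on A" and "\<And>s. s \<in> A \<Longrightarrow> norm (c s) \<le> B"
  shows "(\<lambda>s. f s * c s) summable_on A"
proof (rule abs_summable_summable, rule Infinite_Sum.abs_summable_on_comparison_test[where g = "\<lambda>s. f s * of_real B"])
  show "(\<lambda>s. norm (f s * of_real B)) summable_on A"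
    using summable_on_cmult_left[OF assms(1), of "of_real B"]
    by (simp add: summable_on_iff_abs_summable_on_complex)
  fix s assume "s \<in> A"
  then show "norm (f s * c s) \<le> norm (f s * of_real B)"
    using assms(2)[of s] unfolding norm_mult
    by (intro mult_left_mono) (auto simp: norm_mult)
qed

lemma summable_on_product:
  fixes f g :: "int \<Rightarrow> complex"
  assumes f: "f summable_on A" and g: "g summable_on B"
  shows "(\<lambda>(r, s). f r * g s) summable_on A \<times> B"
proof -
  have f': "(\<lambda>r. norm (f r)) summable_on A" and g': "(\<lambda>s. norm (g s)) summable_on B"
    using f g by (simp_all add: summable_on_iff_abs_summable_on_complex)
  have "(\<lambda>x. norm ((\<lambda>(r, s). f r * g s) x)) summable_on A \<times> B"
  proof (subst Infinite_Sum.abs_summable_on_Sigma_iff, intro conjI ballI)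
    show "(\<lambda>s. norm ((\<lambda>(r, s). f r * g s) (r, s))) summable_on B" for r
      using summable_on_cmult_right[OF g', of "norm (f r)"] by (simp add: norm_mult)
    have "(\<lambda>r. norm (f r) * (\<Sum>\<^sub>\<infinity>s\<in>B. norm (g s))) summable_on A"
      by (rule summable_on_cmult_left[OF f'])
    then show "(\<lambda>r. norm (\<Sum>\<^sub>\<infinity>s\<in>B. norm ((\<lambda>(r, s). f r * g s) (r, s)))) summable_on A"
      by (simp add: norm_mult infsum_cmult_right' infsum_nonneg)
  qed
  then show ?thesis by (rule abs_summable_summable)
qed

section \<open>The coefficients of the theta series\<close>

text \<open>The division by 2 is exact. The Jacobi theta series is
  \<open>\<Sum>\<^sub>s theta_coeff q s * x powi s\<close>, and every bilateral series below has these coefficients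
  as its rapidly decreasing factor.\<close>

definition theta_coeff :: "complex \<Rightarrow> int \<Rightarrow> complex" where
  "theta_coeff q s = (-1) powi s * q powi (s * (s - 1) div 2)"

lemma two_times_triangular: "2 * (s * (s - 1) div 2) = s * (s - 1)" for s :: int
  by simp

locale nome =
  fixes q :: complex
  assumes norm_pos: "0 < norm q" and norm_less: "norm q < 1"
begin

lemma q_nonzero [simp]: "q \<noteq> 0"
  using norm_pos by auto

text \<open>The exponent is a quadratic form with bilinear part \<open>a * b\<close>. This rule turns a product of two
  such series into a sum over the total index, and it shifts the index of a single one.\<close>

lemma theta_coeff_add: "theta_coeff q (a + b) = theta_coeff q a * theta_coeff q b * q powi (a * b)"
proof -
  have "2 * ((a + b) * (a + b - 1) div 2)
      = 2 * (a * (a - 1) div 2 + b * (b - 1) div 2 + a * b)"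
    unfolding distrib_left two_times_triangular by (simp add: algebra_simps)
  then have "(a + b) * (a + b - 1) div 2 = a * (a - 1) div 2 + b * (b - 1) div 2 + a * b"
    by (simp only: mult_cancel_left) simp
  then show ?thesis
    unfolding theta_coeff_def by (simp add: power_int_add)
qed

lemma theta_coeff_reflect: "theta_coeff q (1 - s) = - theta_coeff q s"
proof -
  have "(1 - s) * (1 - s - 1) = s * (s - 1)" by (simp add: algebra_simps)
  then show ?thesis
    unfolding theta_coeff_def by (simp add: power_int_diff power_int_minus_left)
qed

lemma theta_coeff_minus: "theta_coeff q (- s) = theta_coeff q s * q powi s"
  using theta_coeff_add[of "-s" 1] theta_coeff_reflect[of s]
  by (simp add: theta_coeff_def power_int_minus field_simps)

lemma theta_coeff_nonzero [simp]: "theta_coeff q s \<noteq> 0"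
  by (simp add: theta_coeff_def)

lemma theta_coeff_square: "theta_coeff q b * theta_coeff q b = q powi (b * (b - 1))"
proof -
  have "theta_coeff q b * theta_coeff q b = ((-1) powi b * (-1) powi b) * (q powi (b * (b - 1) div 2) * q powi (b * (b - 1) div 2))"
    by (simp only: theta_coeff_def mult_ac)
  also have "(-1 :: complex) powi b * (-1) powi b = 1"
    by (cases "even b") (simp_all add: power_int_minus_left)
  also have "q powi (b * (b - 1) div 2) * q powi (b * (b - 1) div 2) = q powi (2 * (b * (b - 1) div 2))"
    unfolding mult_2 by (rule power_int_add[symmetric]) simp
  also have "2 * (b * (b - 1) div 2) = b * (b - 1)" by (rule two_times_triangular)
  finally show ?thesis by (simp only: mult_1)
qed

lemma summable_theta_coeff_nat:
  assumes "w \<noteq> 0"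
  shows "summable (\<lambda>n. norm (theta_coeff q (int n) * w powi int n))"
proof -
  have "(\<lambda>n. norm w * norm q ^ n) \<longlonglongrightarrow> norm w * 0"
    by (intro tendsto_intros LIMSEQ_power_zero) (use norm_less in auto)
  then have "\<forall>\<^sub>F n in sequentially. norm w * norm q ^ n < 1 / 2"
    by (rule order_tendstoD) simp
  then obtain N where N: "\<And>n. n \<ge> N \<Longrightarrow> norm w * norm q ^ n < 1 / 2"
    by (auto simp: eventually_sequentially)
  show ?thesis
  proof (rule summable_ratio_test[of "1/2" N])
    fix n assume "N \<le> n"
    have *: "theta_coeff q (int (Suc n)) * w powi int (Suc n)
        = - (w * q ^ n) * (theta_coeff q (int n) * w powi int n)"
      using theta_coeff_add[of "int n" 1] assms by (simp add: theta_coeff_def power_int_add add.commute)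
    have "norm (norm (theta_coeff q (int (Suc n)) * w powi int (Suc n)))
        = (norm w * norm q ^ n) * norm (theta_coeff q (int n) * w powi int n)"
      unfolding * by (simp add: norm_mult norm_power)
    also have "\<dots> \<le> 1 / 2 * norm (theta_coeff q (int n) * w powi int n)"
      by (intro mult_right_mono less_imp_le[OF N[OF \<open>N \<le> n\<close>]]) auto
    finally show "norm (norm (theta_coeff q (int (Suc n)) * w powi int (Suc n)))
        \<le> 1 / 2 * norm (norm (theta_coeff q (int n) * w powi int n))" by simp
  qed simp
qed

text \<open>Consecutive terms with index \<open>s \<ge> 0\<close> have ratio \<open>- w * q ^ s\<close>, which tends to 0. The
  reflection \<open>s \<mapsto> 1 - s\<close> reduces the negative indices to this case with \<open>1 / w\<close>.\<close>

lemma summable_theta_coeff: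
  assumes "w \<noteq> 0"
  shows "(\<lambda>s. theta_coeff q s * w powi s) summable_on A"
proof -
  have half: "(\<lambda>s. theta_coeff q s * v powi s) summable_on {0..}" if "v \<noteq> 0" for v
  proof -
    have "(\<lambda>n. theta_coeff q (int n) * v powi int n) summable_on UNIV"
      by (rule norm_summable_imp_summable_on) (rule summable_theta_coeff_nat[OF that])
    then have "(\<lambda>s. theta_coeff q s * v powi s) summable_on (range int)"
      by (subst summable_on_reindex) (auto simp: o_def)
    moreover have "range int = {0..}"
      by (auto simp: image_iff) (metis nat_0_le)
    ultimately show ?thesis by simp
  qed
  have "(\<lambda>s. - w * (theta_coeff q s * (1 / w) powi s)) summable_on {2..}"
    using assms by (intro summable_on_cmult_right summable_on_subset_banach[OF half]) auto
  also have "?this \<longleftrightarrow> (\<lambda>s. theta_coeff q s * w powi s) summable_on {..<0}"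
    by (rule summable_on_reindex_bij_witness[of _ "\<lambda>s. 1 - s" "\<lambda>s. 1 - s"])
       (use assms in \<open>auto simp: theta_coeff_reflect power_int_diff power_int_divide_distrib\<close>)
  finally have "(\<lambda>s. theta_coeff q s * w powi s) summable_on ({0..} \<union> {..<0})"
    using half[OF assms] by (intro summable_on_Un_disjoint) auto
  moreover have "{0..} \<union> {..<0} = (UNIV :: int set)" by auto
  ultimately show ?thesis
    by (metis summable_on_subset_banach subset_UNIV)
qed

lemma summable_bounded_times_theta_coeff:
  assumes "w \<noteq> 0" and "\<And>s. s \<in> A \<Longrightarrow> norm (c s) \<le> B"
  shows "(\<lambda>s. theta_coeff q s * w powi s * c s) summable_on A"
  using summable_bounded_times[OF summable_theta_coeff[OF assms(1)] assms(2)] .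

lemma norm_powi_ge:
  assumes "k < 0" shows "norm (q powi k) \<ge> 1 / norm q"
proof -
  have "norm (q powi k) = inverse (norm q) ^ nat (- k)"
    using assms by (simp add: power_int_def norm_power norm_inverse)
  also have "\<dots> \<ge> inverse (norm q) ^ 1"
    using assms norm_less norm_pos by (intro power_increasing) (auto simp: one_le_inverse_iff)
  finally show ?thesis by (simp add: divide_inverse)
qed

lemma norm_powi_le:
  assumes "k > 0" shows "norm (q powi k) \<le> norm q"
proof -
  have "norm (q powi k) = norm q ^ nat k"
    using assms by (simp add: power_int_def norm_power)
  also have "\<dots> \<le> norm q ^ 1"
    using assms norm_less norm_pos by (intro power_decreasing) auto
  finally show ?thesis by simp
qed

lemma powi_eq_1_iff: "q powi k = 1 \<longleftrightarrow> k = 0"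
proof (cases k "0 :: int" rule: linorder_cases)
  case less
  then show ?thesis using norm_powi_ge[OF less] norm_pos norm_less
    by (auto simp: field_simps)
next
  case greater
  then show ?thesis using norm_powi_le[OF greater] norm_less by auto
qed auto

lemma norm_inverse_one_minus_powi:
  assumes "k \<noteq> 0"
  shows "norm (1 / (1 - q powi k)) \<le> 1 / (1 - norm q)"
proof -
  have "1 - norm q \<le> norm (1 - q powi k)"
  proof (cases "k > 0")
    case True
    then show ?thesis using norm_powi_le[OF True] norm_triangle_ineq2[of 1 "q powi k"] by simp
  next
    case False
    have "(1 - norm q)^2 \<ge> 0" by simp
    then have "1 / norm q - 1 \<ge> 1 - norm q"
      using norm_pos by (simp add: field_simps power2_eq_square)
    then show ?thesis
      using False assms norm_powi_ge[of k] norm_triangle_ineq2[of "q powi k" 1]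
      by (simp add: norm_minus_commute)
  qed
  then show ?thesis using norm_less by (simp add: norm_divide frac_le)
qed

text \<open>The values tend to 1 as \<open>s\<close> tends to infinity and to 0 as \<open>s\<close> tends to minus infinity.\<close>

lemma bounded_inverse_one_minus:
  assumes "z \<noteq> 0" and nz: "\<And>s. 1 - z * q powi s \<noteq> 0"
  obtains B where "\<And>s. norm (1 / (1 - z * q powi s)) \<le> B"
proof -
  have qn: "(\<lambda>n. q ^ n) \<longlonglongrightarrow> 0" using norm_less by (rule LIMSEQ_power_zero)
  have "(\<lambda>n. 1 / (1 - z * q powi int n)) \<longlonglongrightarrow> 1 / (1 - z * 0)"
    unfolding power_int_of_nat by (intro tendsto_intros qn) auto
  then obtain B1 where B1: "\<And>n. norm (1 / (1 - z * q powi int n)) \<le> B1"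
    using convergent_imp_Bseq[of "\<lambda>n. 1 / (1 - z * q powi int n)"] unfolding convergent_def Bseq_def by blast
  have "1 / (1 - z * q powi (- int n)) = q ^ n / (q ^ n - z)" for n
    using nz[of "- int n"] by (simp add: power_int_minus field_simps)
  then have "(\<lambda>n. 1 / (1 - z * q powi (- int n))) \<longlonglongrightarrow> 0 / (0 - z)"
    using assms(1) by (simp only:) (intro tendsto_intros qn, auto)
  then obtain B2 where B2: "\<And>n. norm (1 / (1 - z * q powi (- int n))) \<le> B2"
    using convergent_imp_Bseq[of "\<lambda>n. 1 / (1 - z * q powi (- int n))"] unfolding convergent_def Bseq_def by blast
  have "norm (1 / (1 - z * q powi s)) \<le> max B1 B2" for s
    by (cases s rule: int_cases2) (metis B1 le_max_iff_disj, metis B2 le_max_iff_disj)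
  then show ?thesis by (rule that)
qed

end

section \<open>q-Pochhammer symbols\<close>

lemma qpoch_0 [simp]: "qpoch z q 0 = 1"
  by (simp add: qpoch_def)

lemma qpoch_Suc: "qpoch z q (Suc n) = qpoch z q n * (1 - z * q ^ n)"
  by (simp add: qpoch_def)

lemma qpoch_Suc_shift: "qpoch z q (Suc n) = (1 - z) * qpoch (q * z) q n"
  unfolding qpoch_def prod.lessThan_Suc_shift by (simp add: mult_ac)

text \<open>The value 0 at negative arguments makes the recurrence \<open>inv_qfact_step\<close> hold for all integers,
  so that the finite sums below can be written over all of \<open>\<int>\<close> without boundary terms.\<close>

definition inv_qfact :: "complex \<Rightarrow> int \<Rightarrow> complex" where
  "inv_qfact q k = (if k < 0 then 0 else 1 / qpoch q q (nat k))"

text \<open>The even function of \<open>s\<close> through which the parameter \<open>z\<close> enters the transformed series.\<close>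

definition pole :: "complex \<Rightarrow> complex \<Rightarrow> int \<Rightarrow> complex" where
  "pole q z s = q powi s / ((1 - z * q powi s) * (1 - q powi s / z))"

context nome
begin

lemma convergent_qpoch: "convergent_prod (\<lambda>j. 1 - z * q ^ j)"
proof -
  have "summable (\<lambda>j. norm (1 - z * q ^ j - 1))"
    using norm_less by (auto simp: norm_mult norm_power intro!: summable_mult summable_geometric)
  then show ?thesis
    by (intro abs_convergent_prod_imp_convergent_prod summable_imp_abs_convergent_prod)
qed

lemma qpoch_tendsto: "qpoch z q \<longlonglongrightarrow> qpoch_inf z q"
proof -
  have "(\<lambda>n. qpoch z q (Suc n)) \<longlonglongrightarrow> qpoch_inf z q"
    unfolding qpoch_def qpoch_inf_def lessThan_Suc_atMost
    by (rule convergent_prod_LIMSEQ[OF convergent_qpoch])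
  then show ?thesis by (rule LIMSEQ_imp_Suc)
qed

lemma qpoch_inf_nonzero:
  assumes "\<And>j. z * q ^ j \<noteq> 1" shows "qpoch_inf z q \<noteq> 0"
  unfolding qpoch_inf_def using assms by (intro prodinf_nonzero convergent_qpoch) auto

lemma qpoch_inf_shift: "qpoch_inf z q = (1 - z) * qpoch_inf (q * z) q"
proof (rule LIMSEQ_unique)
  show "(\<lambda>n. qpoch z q (Suc n)) \<longlonglongrightarrow> qpoch_inf z q"
    by (rule LIMSEQ_Suc[OF qpoch_tendsto])
  show "(\<lambda>n. qpoch z q (Suc n)) \<longlonglongrightarrow> (1 - z) * qpoch_inf (q * z) q"
    unfolding qpoch_Suc_shift by (intro tendsto_intros qpoch_tendsto)
qed

lemma q_power_neq_1: "q * q ^ j \<noteq> 1"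
  using powi_eq_1_iff[of "int (Suc j)"] unfolding power_int_of_nat by simp

lemma qpoch_q_nonzero [simp]: "qpoch q q n \<noteq> 0"
  unfolding qpoch_def using q_power_neq_1 by auto

lemma qpoch_inf_q_nonzero [simp]: "qpoch_inf q q \<noteq> 0"
  by (rule qpoch_inf_nonzero) (rule q_power_neq_1)

lemma inv_qfact_step: "(1 - q powi k) * inv_qfact q k = inv_qfact q (k - 1)"
proof (cases "k > 0")
  case True
  then obtain n where k: "k = int (Suc n)" by (metis zero_less_imp_eq_int Suc_pred')
  have "nat (1 + int n) = Suc n" by simp
  then show ?thesis
    unfolding k inv_qfact_def using q_power_neq_1[of n]
    by (simp add: qpoch_Suc power_int_add)
qed (auto simp: inv_qfact_def)

lemma inv_qfact_tendsto: "(\<lambda>n. inv_qfact q (int n + s)) \<longlonglongrightarrow> 1 / qpoch_inf q q"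
proof -
  have "(\<lambda>n. 1 / qpoch q q n) \<longlonglongrightarrow> 1 / qpoch_inf q q"
    by (intro tendsto_intros qpoch_tendsto) auto
  then have "(\<lambda>n. 1 / qpoch q q (n + nat s)) \<longlonglongrightarrow> 1 / qpoch_inf q q"
    by (rule LIMSEQ_ignore_initial_segment)
  also have "(\<lambda>n. 1 / qpoch q q (n + nat s)) = (\<lambda>n. inv_qfact q (int (n + nat (- s)) + s))"
  proof
    fix n
    have "int (n + nat (- s)) + s = int (n + nat s)" by simp
    then show "1 / qpoch q q (n + nat s) = inv_qfact q (int (n + nat (- s)) + s)"
      by (simp only: inv_qfact_def nat_int) simp
  qed
  finally show ?thesis by (rule LIMSEQ_offset)
qed

lemma inv_qfact_bounded: obtains B where "\<And>k. norm (inv_qfact q k) \<le> B"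
proof -
  obtain B where B: "\<And>n. norm (inv_qfact q (int n + 0)) \<le> B"
    using convergent_imp_Bseq[of "\<lambda>n. inv_qfact q (int n + 0)"] inv_qfact_tendsto
    unfolding convergent_def Bseq_def by blast
  have "norm (inv_qfact q k) \<le> B" for k
  proof (cases "k < 0")
    case True
    then show ?thesis using order_trans[OF norm_ge_zero B[of 0]] by (simp add: inv_qfact_def)
  next
    case False
    then show ?thesis using B[of "nat k"] by simp
  qed
  then show ?thesis by (rule that)
qed

lemma inv_qfact2_bounded: obtains B where "\<And>k m. norm (inv_qfact q k * inv_qfact q m) \<le> B"
proof -
  obtain B where B: "\<And>k. norm (inv_qfact q k) \<le> B" using inv_qfact_bounded by blast
  have "norm (inv_qfact q k * inv_qfact q m) \<le> B * B" for k m
    unfolding norm_mult by (intro mult_mono B) (auto intro: order_trans[OF norm_ge_zero B])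
  then show ?thesis by (rule that)
qed

section \<open>The Jacobi triple product\<close>

lemma summable_jacobi_term:
  assumes "x \<noteq> 0"
  shows "(\<lambda>j. theta_coeff q j * x powi j * (inv_qfact q (a - j) * inv_qfact q (b + j))) summable_on A"
proof -
  obtain B where B: "\<And>k m. norm (inv_qfact q k * inv_qfact q m) \<le> B" using inv_qfact2_bounded by blast
  show ?thesis by (rule summable_bounded_times[OF summable_theta_coeff[OF assms] B])
qed

definition jacobi_sum :: "int \<Rightarrow> int \<Rightarrow> complex \<Rightarrow> complex" where
  "jacobi_sum a b x = (\<Sum>\<^sub>\<infinity>j. theta_coeff q j * x powi j * (inv_qfact q (a - j) * inv_qfact q (b + j)))"

text \<open>With \<open>N = a + b\<close>, this is the q-Pascal rule
  \<open>1 - q ^ (N + 1) = (1 - q ^ (a + 1 - j)) + q ^ (a + 1 - j) * (1 - q ^ (b + j))\<close>, applied to each term: the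
  first part lowers \<open>a + 1\<close> to \<open>a\<close>, the second gives the same series shifted by one place.\<close>

lemma jacobi_sum_left:
  assumes "x \<noteq> 0"
  shows "(1 - q powi (a + b + 1)) * jacobi_sum (a + 1) b x = (1 - x * q powi a) * jacobi_sum a b x"
proof -
  define t where "t a b j = theta_coeff q j * x powi j * (inv_qfact q (a - j) * inv_qfact q (b + j))" for a b j
  have t: "t a b summable_on UNIV" for a b
    unfolding t_def by (rule summable_jacobi_term[OF assms])
  have "(1 - q powi (a + b + 1)) * t (a + 1) b j = t a b j + - x * q powi a * t a b (j - 1)" for j
  proof -
    \<comment> \<open>\<open>P * R\<close> is the power of \<open>q\<close> in the q-Pascal rule; \<open>A\<close> and \<open>B\<close> are the larger reciprocals.\<close>
    define P R A B where "P = q powi (a + 1 - j)" and "R = q powi (b + j)"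
      and "A = inv_qfact q (a + 1 - j)" and "B = inv_qfact q (b + j)"
    have PR: "q powi (a + b + 1) = P * R"
      unfolding P_def R_def by (simp add: algebra_simps flip: power_int_add)
    have A: "inv_qfact q (a - j) = (1 - P) * A"
      using inv_qfact_step[of "a + 1 - j"] by (simp add: P_def A_def)
    have B: "inv_qfact q (b + (j - 1)) = (1 - R) * B"
      using inv_qfact_step[of "b + j"] unfolding R_def B_def by (metis add_diff_eq)
    have g: "theta_coeff q j * P = - theta_coeff q (j - 1) * q powi a"
      using theta_coeff_add[of "j - 1" 1] unfolding P_def
      by (simp add: theta_coeff_def power_int_add power_int_diff)
    have "- x * q powi a * t a b (j - 1) = - theta_coeff q (j - 1) * q powi a * (x * x powi (j - 1)) * A * ((1 - R) * B)"
      unfolding t_def B A_def by (simp add: diff_diff_eq2 mult_ac)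
    also have "x * x powi (j - 1) = x powi j" using assms by (simp add: power_int_diff)
    finally have "- x * q powi a * t a b (j - 1) = theta_coeff q j * P * x powi j * A * ((1 - R) * B)"
      unfolding g .
    moreover have "t (a + 1) b j = theta_coeff q j * x powi j * (A * B)" by (simp add: t_def A_def B_def)
    moreover have "t a b j = theta_coeff q j * x powi j * ((1 - P) * A * B)" by (simp add: t_def A B_def)
    ultimately show ?thesis unfolding PR by (simp only:) (simp add: algebra_simps)
  qed
  then have "(1 - q powi (a + b + 1)) * (\<Sum>\<^sub>\<infinity>j. t (a + 1) b j)
      = (\<Sum>\<^sub>\<infinity>j. t a b j + - x * q powi a * t a b (j - 1))"
    by (subst infsum_cmult_right'[symmetric]) simp
  also have "\<dots> = (\<Sum>\<^sub>\<infinity>j. t a b j) + - x * q powi a * (\<Sum>\<^sub>\<infinity>j. t a b (j - 1))"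
  proof -
    have "(\<lambda>j. t a b (j - 1)) summable_on UNIV \<longleftrightarrow> t a b summable_on UNIV"
      by (rule summable_on_reindex_bij_witness[of _ "\<lambda>j. j + 1" "\<lambda>j. j - 1"]) auto
    then show ?thesis
      using infsum_add[OF t[of a b] summable_on_cmult_right[of "\<lambda>j. t a b (j - 1)" UNIV "- x * q powi a"]]
        t[of a b] by (simp only: infsum_cmult_right')
  qed
  also have "(\<Sum>\<^sub>\<infinity>j. t a b (j - 1)) = (\<Sum>\<^sub>\<infinity>j. t a b j)"
    using infsum_int_shift[of "t a b" "-1"] by simp
  finally show ?thesis
    unfolding jacobi_sum_def t_def by (simp add: algebra_simps)
qed

text \<open>The substitution \<open>j \<mapsto> - j\<close> exchanges the two sides of the product, so that the recurrence in
  the first argument also serves for the second.\<close>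

lemma jacobi_sum_swap:
  assumes "x \<noteq> 0"
  shows "jacobi_sum a b x = jacobi_sum b a (q / x)"
proof -
  have "jacobi_sum b a (q / x) = (\<Sum>\<^sub>\<infinity>j. theta_coeff q (-j) * (q / x) powi (-j) * (inv_qfact q (b + j) * inv_qfact q (a - j)))"
    unfolding jacobi_sum_def by (subst infsum_int_minus[symmetric]) simp
  also have "\<dots> = jacobi_sum a b x"
    unfolding jacobi_sum_def using assms
    by (intro infsum_cong) (simp add: theta_coeff_minus power_int_minus power_int_divide_distrib field_simps)
  finally show ?thesis by simp
qed

lemma finite_jacobi_triple_product:
  assumes "x \<noteq> 0"
  shows "qpoch q q (a + b) * jacobi_sum (int a) (int b) x = qpoch x q a * qpoch (q / x) q b"
proof (induction a)
  case 0
  have "qpoch q q b * jacobi_sum 0 (int b) x = qpoch (q / x) q b" if "x \<noteq> 0" for x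
    using that
  proof (induction b arbitrary: x)
    case 0
    have "jacobi_sum 0 0 x = (\<Sum>\<^sub>\<infinity>j\<in>{0::int}. 1)"
      unfolding jacobi_sum_def
      by (rule infsum_cong_neutral) (auto simp: inv_qfact_def theta_coeff_def)
    then show ?case by simp
  next
    case (Suc b)
    let ?y = "q / x"
    have y: "?y \<noteq> 0" using Suc.prems by simp
    have "qpoch q q (Suc b) * jacobi_sum 0 (int (Suc b)) x
        = qpoch q q b * ((1 - q powi (int b + 0 + 1)) * jacobi_sum (int b + 1) 0 ?y)"
      unfolding jacobi_sum_swap[OF Suc.prems, of 0] qpoch_Suc
      by (simp add: power_int_add add.commute mult_ac)
    also have "\<dots> = qpoch q q b * jacobi_sum 0 (int b) x * (1 - ?y * q ^ b)"
      unfolding jacobi_sum_left[OF y] by (simp flip: jacobi_sum_swap[OF Suc.prems])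
    finally show ?case using Suc by (simp add: qpoch_Suc)
  qed
  then show ?case using assms by simp
next
  case (Suc a)
  have "qpoch q q (Suc a + b) * jacobi_sum (int (Suc a)) (int b) x
      = qpoch q q (a + b) * ((1 - q powi (int a + int b + 1)) * jacobi_sum (int a + 1) (int b) x)"
    by (simp add: qpoch_Suc power_int_add add.commute mult_ac power_add)
  also have "\<dots> = (1 - x * q ^ a) * (qpoch q q (a + b) * jacobi_sum (int a) (int b) x)"
    unfolding jacobi_sum_left[OF assms] by simp
  finally show ?case by (simp add: Suc.IH qpoch_Suc)
qed

text \<open>The limit \<open>a = b \<rightarrow> \<infinity>\<close> of the finite form.\<close>

lemma jacobi_triple_product:
  assumes "x \<noteq> 0"
  shows "(\<Sum>\<^sub>\<infinity>s. theta_coeff q s * x powi s) = qpoch_inf x q * qpoch_inf (q / x) q * qpoch_inf q q"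
proof -
  obtain B where B: "\<And>k m. norm (inv_qfact q k * inv_qfact q m) \<le> B" using inv_qfact2_bounded by blast
  have "(\<lambda>n. jacobi_sum (int n) (int n) x) \<longlonglongrightarrow>
      (\<Sum>\<^sub>\<infinity>s. theta_coeff q s * x powi s * (1 / qpoch_inf q q * (1 / qpoch_inf q q)))"
    unfolding jacobi_sum_def
  proof (rule tendsto_infsum_dominated)
    show "(\<lambda>n. theta_coeff q s * x powi s * (inv_qfact q (int n - s) * inv_qfact q (int n + s)))
        \<longlonglongrightarrow> theta_coeff q s * x powi s * (1 / qpoch_inf q q * (1 / qpoch_inf q q))" for s
      using inv_qfact_tendsto[of "-s"] by (intro tendsto_intros inv_qfact_tendsto) auto
    show "norm (theta_coeff q s * x powi s * (inv_qfact q (int n - s) * inv_qfact q (int n + s)))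
        \<le> norm (theta_coeff q s * x powi s) * B" for n s
      unfolding norm_mult[of "theta_coeff q s * x powi s"] by (intro mult_left_mono B) auto
    show "(\<lambda>s. norm (theta_coeff q s * x powi s) * B) summable_on UNIV"
      using summable_theta_coeff[OF assms, of UNIV] unfolding summable_on_iff_abs_summable_on_complex
      by (rule summable_on_cmult_left)
  qed
  moreover have "(\<lambda>n. qpoch q q (n + n)) \<longlonglongrightarrow> qpoch_inf q q"
    using LIMSEQ_subseq_LIMSEQ[OF qpoch_tendsto[of q], of "\<lambda>n. n + n"]
    by (auto simp: strict_mono_def o_def)
  ultimately have "(\<lambda>n. qpoch q q (n + n) * jacobi_sum (int n) (int n) x) \<longlonglongrightarrow>
      qpoch_inf q q * ((\<Sum>\<^sub>\<infinity>s. theta_coeff q s * x powi s) * (1 / qpoch_inf q q * (1 / qpoch_inf q q)))"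
    by (subst infsum_cmult_left'[symmetric]) (rule tendsto_mult)
  moreover have "(\<lambda>n. qpoch q q (n + n) * jacobi_sum (int n) (int n) x) \<longlonglongrightarrow>
      qpoch_inf x q * qpoch_inf (q / x) q"
    unfolding finite_jacobi_triple_product[OF assms] by (intro tendsto_intros qpoch_tendsto)
  ultimately have "qpoch_inf q q * ((\<Sum>\<^sub>\<infinity>s. theta_coeff q s * x powi s) * (1 / qpoch_inf q q * (1 / qpoch_inf q q)))
      = qpoch_inf x q * qpoch_inf (q / x) q"
    by (rule LIMSEQ_unique)
  then show ?thesis by (simp add: field_simps)
qed

section \<open>The Bailey transform\<close>

text \<open>The partial sums of this q-Gauss sum have a closed form, hence induction on \<open>N\<close>. The induction
  step is the identity \<open>(1 - z * w) * (1 - w / z) - (1 - w / u) * (1 - w * u) = w / pole\<close> for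
  \<open>u = q powi s\<close> and \<open>w = q ^ (N + 1)\<close>.\<close>

lemma finite_conjugate_sum:
  assumes z: "z \<noteq> 0" "\<And>s. z * q powi s \<noteq> 1"
  shows "(\<Sum>n\<le>N. qpoch z q n * qpoch (inverse z) q n * q ^ n * (inv_qfact q (int n - s) * inv_qfact q (int n + s)))
     = qpoch z q (Suc N) * qpoch (inverse z) q (Suc N) * (pole q z s * (inv_qfact q (int N - s) * inv_qfact q (int N + s)))"
proof -
  define u where "u = q powi s"
  have u: "u \<noteq> 0" by (simp add: u_def)
  have nz: "1 - z * u \<noteq> 0" "1 - u / z \<noteq> 0"
    using z(2)[of s] z(2)[of "-s"] z(1) by (auto simp: u_def power_int_minus field_simps)
  have p: "pole q z s = u / ((1 - z * u) * (1 - u / z))" by (simp add: pole_def u_def)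
  show ?thesis
  proof (induction N)
    case 0
    show ?case
    proof (cases "s = 0")
      case True
      have "(1 - z) * (1 - inverse z) \<noteq> 0"
        using True nz by (simp add: u_def inverse_eq_divide)
      moreover have "pole q z s = 1 / ((1 - z) * (1 - inverse z))"
        by (simp add: True pole_def inverse_eq_divide)
      ultimately show ?thesis by (simp add: qpoch_Suc)
    qed (auto simp: inv_qfact_def)
  next
    case (Suc N)
    define w where "w = q ^ Suc N"
    define R where "R = inv_qfact q (int (Suc N) - s) * inv_qfact q (int (Suc N) + s)"
    have "inv_qfact q (int N - s) = (1 - w / u) * inv_qfact q (int (Suc N) - s)"
      using inv_qfact_step[of "int (Suc N) - s"] unfolding w_def u_def
      by (simp add: power_int_diff power_int_add)
    moreover have "inv_qfact q (int N + s) = (1 - w * u) * inv_qfact q (int (Suc N) + s)"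
      using inv_qfact_step[of "int (Suc N) + s"] unfolding w_def u_def
      by (simp add: power_int_add mult_ac add_ac)
    ultimately have R': "inv_qfact q (int N - s) * inv_qfact q (int N + s) = (1 - w / u) * (1 - w * u) * R"
      by (simp add: R_def)
    have key: "pole q z s * ((1 - w / u) * (1 - w * u)) + w
        = (1 - z * w) * (1 - inverse z * w) * pole q z s"
      unfolding p using u z(1) nz by (simp add: divide_simps) (simp add: algebra_simps)
    show ?case
      unfolding sum.atMost_Suc Suc.IH R' qpoch_Suc[of _ _ "Suc N"]
        R_def[symmetric] w_def[symmetric]
      using arg_cong[OF key, of "\<lambda>x. qpoch z q (Suc N) * qpoch (inverse z) q (Suc N) * R * x"]
      by (simp add: algebra_simps)
  qed
qed

lemma pole_bounded:
  assumes z: "z \<noteq> 0" "\<And>s. z * q powi s \<noteq> 1"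
  obtains B where "\<And>s. norm (pole q z s) \<le> B"
proof -
  have nz: "1 - z * q powi s \<noteq> 0" "1 - inverse z * q powi s \<noteq> 0" for s
    using z(2)[of s] z(2)[of "-s"] z(1) by (auto simp: power_int_minus field_simps)
  obtain B1 where B1: "\<And>s. norm (1 / (1 - z * q powi s)) \<le> B1"
    using bounded_inverse_one_minus[of z] nz z by blast
  obtain B2 where B2: "\<And>s. norm (1 / (1 - inverse z * q powi s)) \<le> B2"
    using bounded_inverse_one_minus[of "inverse z"] nz z by (metis inverse_nonzero_iff_nonzero)
  have "norm (pole q z s) \<le> B1 * (norm z * (B2 + 1))" for s
  proof -
    have eq: "pole q z s = 1 / (1 - z * q powi s) * (z * (1 / (1 - inverse z * q powi s) - 1))"
      unfolding pole_def using nz[of s] z(1) by (simp add: divide_simps)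
    have "norm (1 / (1 - inverse z * q powi s) - 1) \<le> B2 + 1"
      using norm_triangle_ineq4[of "1 / (1 - inverse z * q powi s)" 1] B2[of s] by simp
    then have "norm (z * (1 / (1 - inverse z * q powi s) - 1)) \<le> norm z * (B2 + 1)"
      unfolding norm_mult by (intro mult_left_mono) auto
    then show ?thesis
      unfolding eq norm_mult[of "1 / (1 - z * q powi s)"]
      using order_trans[OF norm_ge_zero B1] by (intro mult_mono B1) auto
  qed
  then show ?thesis by (rule that)
qed

text \<open>Bailey's transform: in the partial sums the order of summation is exchanged, the inner sum has the
  closed form of \<open>finite_conjugate_sum\<close>, and dominated convergence gives the limit.\<close>

lemma bailey_sum:
  assumes z: "z \<noteq> 0" "\<And>s. z * q powi s \<noteq> 1"
    and \<alpha>: "\<alpha> summable_on UNIV"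
    and \<beta>: "\<And>n. \<beta> n = (\<Sum>\<^sub>\<infinity>s. \<alpha> s * (inv_qfact q (int n - s) * inv_qfact q (int n + s)))"
  shows "(\<lambda>n. qpoch z q n * qpoch (inverse z) q n * q ^ n * \<beta> n) sums
     (qpoch_inf z q * qpoch_inf (inverse z) q / (qpoch_inf q q)\<^sup>2 * (\<Sum>\<^sub>\<infinity>s. \<alpha> s * pole q z s))"
proof -
  obtain B where B: "\<And>k m. norm (inv_qfact q k * inv_qfact q m) \<le> B" using inv_qfact2_bounded by blast
  obtain B' where B': "\<And>s. norm (pole q z s) \<le> B'" using pole_bounded[OF z] by blast
  have \<alpha>p: "(\<lambda>s. \<alpha> s * pole q z s) summable_on UNIV"
    by (rule summable_bounded_times[OF \<alpha> B'])
  have partial: "(\<Sum>n\<le>N. qpoch z q n * qpoch (inverse z) q n * q ^ n * \<beta> n)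
      = qpoch z q (Suc N) * qpoch (inverse z) q (Suc N)
        * (\<Sum>\<^sub>\<infinity>s. \<alpha> s * pole q z s * (inv_qfact q (int N - s) * inv_qfact q (int N + s)))" for N
  proof -
    let ?d = "\<lambda>n. qpoch z q n * qpoch (inverse z) q n * q ^ n"
    have "(\<Sum>n\<le>N. ?d n * \<beta> n)
        = (\<Sum>n\<le>N. \<Sum>\<^sub>\<infinity>s. ?d n * (\<alpha> s * (inv_qfact q (int n - s) * inv_qfact q (int n + s))))"
      unfolding \<beta> by (simp add: infsum_cmult_right')
    also have "\<dots> = (\<Sum>\<^sub>\<infinity>s. \<Sum>n\<le>N. ?d n * (\<alpha> s * (inv_qfact q (int n - s) * inv_qfact q (int n + s))))"
      by (intro infsum_sum_swap summable_on_cmult_right summable_bounded_times[OF \<alpha> B]) auto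
    also have "\<dots> = (\<Sum>\<^sub>\<infinity>s. \<alpha> s * (\<Sum>n\<le>N. ?d n * (inv_qfact q (int n - s) * inv_qfact q (int n + s))))"
      by (simp add: sum_distrib_left mult_ac)
    also have "\<dots> = (\<Sum>\<^sub>\<infinity>s. qpoch z q (Suc N) * qpoch (inverse z) q (Suc N)
        * (\<alpha> s * pole q z s * (inv_qfact q (int N - s) * inv_qfact q (int N + s))))"
      unfolding finite_conjugate_sum[OF z] by (simp add: mult_ac)
    finally show ?thesis by (simp add: infsum_cmult_right')
  qed
  have "(\<lambda>N. \<Sum>\<^sub>\<infinity>s. \<alpha> s * pole q z s * (inv_qfact q (int N - s) * inv_qfact q (int N + s)))
      \<longlonglongrightarrow> (\<Sum>\<^sub>\<infinity>s. \<alpha> s * pole q z s * (1 / qpoch_inf q q * (1 / qpoch_inf q q)))"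
  proof (rule tendsto_infsum_dominated)
    show "(\<lambda>n. \<alpha> s * pole q z s * (inv_qfact q (int n - s) * inv_qfact q (int n + s)))
        \<longlonglongrightarrow> \<alpha> s * pole q z s * (1 / qpoch_inf q q * (1 / qpoch_inf q q))" for s
      using inv_qfact_tendsto[of "-s"] by (intro tendsto_intros inv_qfact_tendsto) auto
    show "norm (\<alpha> s * pole q z s * (inv_qfact q (int n - s) * inv_qfact q (int n + s)))
        \<le> norm (\<alpha> s * pole q z s) * B" for n s
      unfolding norm_mult[of "\<alpha> s * pole q z s"] by (intro mult_left_mono B) auto
    show "(\<lambda>s. norm (\<alpha> s * pole q z s) * B) summable_on UNIV"
      using \<alpha>p unfolding summable_on_iff_abs_summable_on_complex
      by (rule summable_on_cmult_left)
  qed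
  then have "(\<lambda>N. \<Sum>n\<le>N. qpoch z q n * qpoch (inverse z) q n * q ^ n * \<beta> n) \<longlonglongrightarrow>
      qpoch_inf z q * qpoch_inf (inverse z) q *
        (\<Sum>\<^sub>\<infinity>s. \<alpha> s * pole q z s * (1 / qpoch_inf q q * (1 / qpoch_inf q q)))"
    unfolding partial by (intro tendsto_mult LIMSEQ_Suc qpoch_tendsto)
  then show ?thesis
    unfolding sums_def_le infsum_cmult_left' by (simp add: power2_eq_square mult_ac)
qed

end

section \<open>Bilateral series for F and G\<close>

text \<open>The numerator that accompanies \<open>theta_coeff\<close> in the expansions of \<open>F\<close> and \<open>G\<close>. The first two
  terms produce \<open>(\<rho>;q)\<^sub>n (1/\<rho>;q)\<^sub>n\<close>. The other two contribute a multiple of \<open>(1;q)\<^sub>n\<close>, which is 0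
  for \<open>n > 0\<close>; they cancel the term \<open>n = 0\<close>, which is missing in \<open>F\<close> and \<open>G\<close>.\<close>

definition spt_weight :: "complex \<Rightarrow> int \<Rightarrow> complex" where
  "spt_weight \<rho> s = inverse \<rho> powi s + \<rho> powi (s + 1) - 1 - \<rho>"

context nome
begin

lemma jacobi_sum_eq:
  "x \<noteq> 0 \<Longrightarrow> jacobi_sum (int n) (int n) x = qpoch x q n * qpoch (q / x) q n / qpoch q q (2 * n)"
  using finite_jacobi_triple_product[of x n n] unfolding mult_2 by (simp add: nonzero_eq_divide_eq mult.commute)

lemma qpoch_one: "qpoch 1 q n = (if n = 0 then 1 else 0)"
  by (cases n) (auto simp: qpoch_Suc_shift)

lemma infsum_theta_coeff_zero: "(\<Sum>\<^sub>\<infinity>s. theta_coeff q s) = 0"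
  using jacobi_triple_product[of 1] qpoch_inf_shift[of 1] by simp

lemma spt_weight_expand:
  assumes "\<rho> \<noteq> 0" "w \<noteq> 0"
  shows "theta_coeff q s * w powi s * spt_weight \<rho> s
     = theta_coeff q s * (w / \<rho>) powi s + \<rho> * (theta_coeff q s * (w * \<rho>) powi s) - (1 + \<rho>) * (theta_coeff q s * w powi s)"
  unfolding spt_weight_def using assms
  by (simp add: power_int_add power_int_divide_distrib power_int_mult_distrib
      power_int_inverse field_simps)

lemma summable_spt_weight:
  assumes "\<rho> \<noteq> 0" "w \<noteq> 0"
  shows "(\<lambda>s. theta_coeff q s * w powi s * spt_weight \<rho> s) summable_on A"
  unfolding spt_weight_expand[OF assms] using assms
  by (intro summable_on_minus summable_on_add summable_on_cmult_right summable_theta_coeff) auto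

text \<open>Each term of the weight gives one finite Jacobi triple product.\<close>

lemma spt_weight_bailey:
  assumes \<rho>: "\<rho> \<noteq> 0" and w: "w \<noteq> 0"
  shows "(\<Sum>\<^sub>\<infinity>s. theta_coeff q s * w powi s * spt_weight \<rho> s * (inv_qfact q (int n - s) * inv_qfact q (int n + s)))
     = (qpoch (w / \<rho>) q n * qpoch (q * \<rho> / w) q n + \<rho> * qpoch (w * \<rho>) q n * qpoch (q / (w * \<rho>)) q n
        - (1 + \<rho>) * qpoch w q n * qpoch (q / w) q n) / qpoch q q (2 * n)"
proof -
  define t where "t x s = theta_coeff q s * x powi s * (inv_qfact q (int n - s) * inv_qfact q (int n + s))" for x s
  have t: "(t x has_sum jacobi_sum (int n) (int n) x) UNIV" if "x \<noteq> 0" for x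
    unfolding t_def jacobi_sum_def by (intro has_sum_infsum summable_jacobi_term that)
  have "((\<lambda>s. t (w / \<rho>) s + \<rho> * t (w * \<rho>) s - (1 + \<rho>) * t w s) has_sum
      (jacobi_sum (int n) (int n) (w / \<rho>) + \<rho> * jacobi_sum (int n) (int n) (w * \<rho>)
        - (1 + \<rho>) * jacobi_sum (int n) (int n) w)) UNIV"
    using \<rho> w by (intro has_sum_minus has_sum_add has_sum_cmult_right t) auto
  also have "(\<lambda>s. t (w / \<rho>) s + \<rho> * t (w * \<rho>) s - (1 + \<rho>) * t w s)
      = (\<lambda>s. theta_coeff q s * w powi s * spt_weight \<rho> s * (inv_qfact q (int n - s) * inv_qfact q (int n + s)))"
    unfolding spt_weight_expand[OF \<rho> w] t_def by (simp add: algebra_simps)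
  finally show ?thesis
    using \<rho> w by (simp add: infsumI jacobi_sum_eq add_divide_distrib diff_divide_distrib mult_ac)
qed

lemma qpoch_q_times:
  assumes "x \<noteq> 1"
  shows "qpoch (q * x) q n = qpoch x q n * (1 - x * q ^ n) / (1 - x)"
  using qpoch_Suc[of x q n] qpoch_Suc_shift[of x q n] assms by (simp add: field_simps)

text \<open>With \<open>w = 1\<close> the first two triple products are \<open>(\<rho>;q)\<^sub>n (1/\<rho>;q)\<^sub>n\<close> times rational factors that
  add up to \<open>1 + \<rho>\<close>, and the third one contains \<open>(1;q)\<^sub>n\<close>.\<close>

lemma spt_weight_bailey_0:
  assumes \<rho>: "\<rho> \<noteq> 0" "\<rho> \<noteq> 1"
  shows "(\<Sum>\<^sub>\<infinity>s. theta_coeff q s * 1 powi s * spt_weight \<rho> s * (inv_qfact q (int n - s) * inv_qfact q (int n + s)))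
     = (if n = 0 then 0 else (1 + \<rho>) * (qpoch \<rho> q n * qpoch (inverse \<rho>) q n) / qpoch q q (2 * n))"
proof -
  define a b v where "a = qpoch \<rho> q n" and "b = qpoch (inverse \<rho>) q n" and "v = q ^ n"
  have i: "inverse \<rho> \<noteq> 1" using \<rho> by (metis inverse_1 inverse_inverse_eq)
  have eqs: "qpoch (q * \<rho>) q n = a * (1 - \<rho> * v) / (1 - \<rho>)"
    "qpoch (q / \<rho>) q n = b * (1 - inverse \<rho> * v) / (1 - inverse \<rho>)"
    using qpoch_q_times[OF \<rho>(2), of n] qpoch_q_times[OF i, of n]
    by (simp_all add: a_def b_def v_def divide_inverse)
  have "b * (a * (1 - \<rho> * v) / (1 - \<rho>)) + \<rho> * a * (b * (1 - inverse \<rho> * v) / (1 - inverse \<rho>))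
      = (1 + \<rho>) * (a * b)"
  proof -
    have "(1 - inverse \<rho> * v) / (1 - inverse \<rho>) = (v - \<rho>) / (1 - \<rho>)"
      using \<rho> i by (simp add: divide_simps) (simp add: algebra_simps)
    then have "b * (a * (1 - \<rho> * v) / (1 - \<rho>)) + \<rho> * a * (b * (1 - inverse \<rho> * v) / (1 - inverse \<rho>))
      = a * b * ((1 - \<rho> * v) / (1 - \<rho>)) + \<rho> * (a * b) * ((v - \<rho>) / (1 - \<rho>))"
      by (simp add: mult_ac flip: times_divide_eq_right)
    also have "\<dots> = a * b * ((1 - \<rho> * v) + \<rho> * (v - \<rho>)) / (1 - \<rho>)"
      by (simp add: algebra_simps add_divide_distrib diff_divide_distrib)
    also have "(1 - \<rho> * v) + \<rho> * (v - \<rho>) = (1 + \<rho>) * (1 - \<rho>)" by (simp add: algebra_simps)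
    finally show ?thesis using \<rho> by simp
  qed
  then show ?thesis
    using spt_weight_bailey[OF \<rho>(1), of 1 n] eqs
    by (auto simp: qpoch_one inverse_eq_divide a_def b_def)
qed

text \<open>With \<open>w = q\<close> the same triple products occur in the other order, and the rational factors now add
  up to \<open>(1 + \<rho>) * q ^ n\<close>. This additional \<open>q ^ n\<close> is what leads from \<open>F\<close> to \<open>G\<close>.\<close>

lemma spt_weight_bailey_1:
  assumes \<rho>: "\<rho> \<noteq> 0" "\<rho> \<noteq> 1"
  shows "(\<Sum>\<^sub>\<infinity>s. theta_coeff q s * q powi s * spt_weight \<rho> s * (inv_qfact q (int n - s) * inv_qfact q (int n + s)))
     = (if n = 0 then 0 else (1 + \<rho>) * (qpoch \<rho> q n * qpoch (inverse \<rho>) q n * q ^ n) / qpoch q q (2 * n))"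
proof -
  define a b v where "a = qpoch \<rho> q n" and "b = qpoch (inverse \<rho>) q n" and "v = q ^ n"
  have i: "inverse \<rho> \<noteq> 1" using \<rho> by (metis inverse_1 inverse_inverse_eq)
  have eqs: "qpoch (q * \<rho>) q n = a * (1 - \<rho> * v) / (1 - \<rho>)"
    "qpoch (q / \<rho>) q n = b * (1 - inverse \<rho> * v) / (1 - inverse \<rho>)"
    using qpoch_q_times[OF \<rho>(2), of n] qpoch_q_times[OF i, of n]
    by (simp_all add: a_def b_def v_def divide_inverse)
  have "b * (1 - inverse \<rho> * v) / (1 - inverse \<rho>) * a + \<rho> * (a * (1 - \<rho> * v) / (1 - \<rho>)) * b
      = (1 + \<rho>) * (a * b * v)"
  proof -
    have "(1 - inverse \<rho> * v) / (1 - inverse \<rho>) = (v - \<rho>) / (1 - \<rho>)"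
      using \<rho> i by (simp add: divide_simps) (simp add: algebra_simps)
    then have "b * (1 - inverse \<rho> * v) / (1 - inverse \<rho>) * a + \<rho> * (a * (1 - \<rho> * v) / (1 - \<rho>)) * b
      = a * b * ((v - \<rho>) / (1 - \<rho>)) + \<rho> * (a * b) * ((1 - \<rho> * v) / (1 - \<rho>))"
      by (simp add: mult_ac flip: times_divide_eq_right)
    also have "\<dots> = a * b * ((v - \<rho>) + \<rho> * (1 - \<rho> * v)) / (1 - \<rho>)"
      by (simp add: algebra_simps add_divide_distrib diff_divide_distrib)
    also have "(v - \<rho>) + \<rho> * (1 - \<rho> * v) = (1 + \<rho>) * v * (1 - \<rho>)" by (simp add: algebra_simps)
    finally show ?thesis using \<rho> by simp
  qed
  then show ?thesis
    using spt_weight_bailey[OF \<rho>(1), of q n] eqs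
    by (auto simp: qpoch_one inverse_eq_divide a_def b_def v_def)
qed

lemma qpochs_tendsto: "qpochs zs q \<longlonglongrightarrow> qpochs_inf zs q"
  unfolding qpochs_def qpochs_inf_def
  by (induction zs) (auto intro!: tendsto_mult qpoch_tendsto)

lemma summable_q_series:
  assumes "norm w < 1"
  shows "summable (\<lambda>n. norm (qpochs zs q n * w ^ n / qpoch q q (2 * n)))"
proof -
  have "(\<lambda>n. qpoch q q (2 * n)) \<longlonglongrightarrow> qpoch_inf q q"
    using LIMSEQ_subseq_LIMSEQ[OF qpoch_tendsto[of q], of "\<lambda>n. 2 * n"]
    by (auto simp: strict_mono_def o_def)
  then have "(\<lambda>n. qpochs zs q n / qpoch q q (2 * n)) \<longlonglongrightarrow> qpochs_inf zs q / qpoch_inf q q"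
    by (intro tendsto_intros qpochs_tendsto) auto
  then obtain B where B: "\<And>n. norm (qpochs zs q n / qpoch q q (2 * n)) \<le> B"
    using convergent_imp_Bseq[of "\<lambda>n. qpochs zs q n / qpoch q q (2 * n)"]
    unfolding convergent_def Bseq_def by blast
  show ?thesis
  proof (rule summable_comparison_test')
    show "summable (\<lambda>n. B * norm w ^ n)" using assms by (intro summable_mult summable_geometric) auto
    fix n
    have "norm (qpochs zs q n * w ^ n / qpoch q q (2 * n))
        = norm (qpochs zs q n / qpoch q q (2 * n)) * norm w ^ n"
      by (simp add: norm_mult norm_divide norm_power)
    also have "\<dots> \<le> B * norm w ^ n" by (intro mult_right_mono B) auto
    finally show "norm (norm (qpochs zs q n * w ^ n / qpoch q q (2 * n))) \<le> B * norm w ^ n" by simp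
  qed
qed

text \<open>The common part of the expansions of \<open>F\<close> (with \<open>w = v = 1\<close>) and of \<open>G\<close> (with \<open>w = v = q\<close>).\<close>

lemma spt_sum_expansion:
  assumes z: "z \<noteq> 0" "\<And>s. z * q powi s \<noteq> 1" and \<rho>: "\<rho> \<noteq> 0" "\<And>s. \<rho> * q powi s \<noteq> 1"
    and w: "w \<noteq> 0" "norm u < 1"
    and beta: "\<And>n. (\<Sum>\<^sub>\<infinity>s. theta_coeff q s * w powi s * spt_weight \<rho> s * (inv_qfact q (int n - s) * inv_qfact q (int n + s)))
      = (if n = 0 then 0 else (1 + \<rho>) * (qpoch \<rho> q n * qpoch (inverse \<rho>) q n * v ^ n) / qpoch q q (2 * n))"
    and u: "u = q * v"
  shows "(1 + \<rho>) * (qpoch_inf q q / qpochs_inf [z, inverse z, \<rho>, inverse \<rho>] q *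
      (\<Sum>\<^sub>\<infinity>n\<in>{1..}. qpochs [z, inverse z, \<rho>, inverse \<rho>] q n * u ^ n / qpoch q q (2 * n)))
      * (qpoch_inf \<rho> q * qpoch_inf (inverse \<rho>) q * qpoch_inf q q)
    = (\<Sum>\<^sub>\<infinity>s. theta_coeff q s * w powi s * spt_weight \<rho> s * pole q z s)"
proof -
  let ?zs = "[z, inverse z, \<rho>, inverse \<rho>]"
  let ?f = "\<lambda>n. qpochs ?zs q n * u ^ n / qpoch q q (2 * n)"
  let ?R = "\<Sum>\<^sub>\<infinity>s. theta_coeff q s * w powi s * spt_weight \<rho> s * pole q z s"
  have nz: "qpoch_inf x q \<noteq> 0" "qpoch_inf (inverse x) q \<noteq> 0"
    if "x \<noteq> 0" "\<And>s. x * q powi s \<noteq> 1" for x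
  proof -
    show "qpoch_inf x q \<noteq> 0"
      by (rule qpoch_inf_nonzero) (metis that(2) power_int_of_nat)
    have "inverse x * q ^ j \<noteq> 1" for j
      using that(1) that(2)[of "- int j"] by (auto simp: power_int_minus field_simps)
    then show "qpoch_inf (inverse x) q \<noteq> 0" by (rule qpoch_inf_nonzero)
  qed
  let ?b = "\<lambda>n. if n = 0 then 0 else (1 + \<rho>) * (qpoch \<rho> q n * qpoch (inverse \<rho>) q n * v ^ n) / qpoch q q (2 * n)"
  have "(\<lambda>n. qpoch z q n * qpoch (inverse z) q n * q ^ n * ?b n) sums
      (qpoch_inf z q * qpoch_inf (inverse z) q / (qpoch_inf q q)\<^sup>2 * ?R)"
    by (rule bailey_sum[OF z summable_spt_weight[OF \<rho>(1) w(1)]]) (rule beta[symmetric])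
  also have "(\<lambda>n. qpoch z q n * qpoch (inverse z) q n * q ^ n * ?b n)
      = (\<lambda>n. if n = 0 then 0 else (1 + \<rho>) * ?f n)"
    by (auto simp: qpochs_def u power_mult_distrib)
  finally have *: "(\<lambda>n. if n = 0 then 0 else (1 + \<rho>) * ?f n) sums
      (qpoch_inf z q * qpoch_inf (inverse z) q / (qpoch_inf q q)\<^sup>2 * ?R)" .
  have "summable (\<lambda>n. norm (if n = 0 then 0 else (1 + \<rho>) * ?f n))"
    by (rule summable_comparison_test'[OF summable_mult[OF summable_q_series[OF w(2), of ?zs], of "norm (1 + \<rho>)"]])
       (auto simp: norm_mult norm_divide)
  then have "((\<lambda>n. if n = 0 then 0 else (1 + \<rho>) * ?f n) has_sum
      (qpoch_inf z q * qpoch_inf (inverse z) q / (qpoch_inf q q)\<^sup>2 * ?R)) UNIV"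
    using * by (rule norm_summable_imp_has_sum)
  then have "((\<lambda>n. (1 + \<rho>) * ?f n) has_sum
      (qpoch_inf z q * qpoch_inf (inverse z) q / (qpoch_inf q q)\<^sup>2 * ?R)) {1..}"
    by (rule has_sum_cong_neutral[THEN iffD1, rotated -1]) auto
  then have "(1 + \<rho>) * (\<Sum>\<^sub>\<infinity>n\<in>{1..}. ?f n)
      = qpoch_inf z q * qpoch_inf (inverse z) q / (qpoch_inf q q)\<^sup>2 * ?R"
    by (simp add: infsum_cmult_right' infsumI flip: infsum_cmult_right')
  moreover have "(1 + \<rho>) * (qpoch_inf q q / qpochs_inf ?zs q * X) * (qpoch_inf \<rho> q * qpoch_inf (inverse \<rho>) q * qpoch_inf q q)
      = (1 + \<rho>) * X * (qpoch_inf q q)\<^sup>2 / (qpoch_inf z q * qpoch_inf (inverse z) q)" for X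
    using nz[OF \<rho>] nz[OF z] by (simp add: qpochs_inf_def field_simps power2_eq_square)
  moreover have "qpoch_inf z q * qpoch_inf (inverse z) q / (qpoch_inf q q)\<^sup>2 * ?R * (qpoch_inf q q)\<^sup>2
      / (qpoch_inf z q * qpoch_inf (inverse z) q) = ?R"
    using nz[OF z] by simp
  ultimately show ?thesis by simp
qed

theorem F_expansion:
  assumes z: "z \<noteq> 0" "\<And>s. z * q powi s \<noteq> 1" and \<rho>: "\<rho> \<noteq> 0" "\<And>s. \<rho> * q powi s \<noteq> 1"
  shows "(1 + \<rho>) * F \<rho> (inverse \<rho>) z q * (qpoch_inf \<rho> q * qpoch_inf (inverse \<rho>) q * qpoch_inf q q)
    = (\<Sum>\<^sub>\<infinity>s. theta_coeff q s * spt_weight \<rho> s * pole q z s)"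
proof -
  have r1: "\<rho> \<noteq> 1" using \<rho>(2)[of 0] by simp
  show ?thesis
    using spt_sum_expansion[OF z \<rho>, of 1 q 1] spt_weight_bailey_0[OF \<rho>(1) r1] norm_less \<rho>(1)
    unfolding F_def by simp
qed

theorem G_expansion:
  assumes z: "z \<noteq> 0" "\<And>s. z * q powi s \<noteq> 1" and \<rho>: "\<rho> \<noteq> 0" "\<And>s. \<rho> * q powi s \<noteq> 1"
  shows "(1 + \<rho>) * G \<rho> (inverse \<rho>) z q * (qpoch_inf \<rho> q * qpoch_inf (inverse \<rho>) q * qpoch_inf q q)
    = (\<Sum>\<^sub>\<infinity>s. theta_coeff q s * q powi s * spt_weight \<rho> s * pole q z s)"
proof -
  have r1: "\<rho> \<noteq> 1" using \<rho>(2)[of 0] by simp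
  have "norm (q * q) < 1" using norm_less norm_pos
    by (metis norm_mult mult_strict_mono norm_ge_zero mult_1 zero_less_one)
  then show ?thesis
    using spt_sum_expansion[OF z \<rho>, of q "q * q" q] spt_weight_bailey_1[OF \<rho>(1) r1] \<rho>(1)
    unfolding G_def by (simp add: power2_eq_square)
qed

section \<open>A theta quotient as a bilateral series\<close>

text \<open>The trivial Bailey pair, whose \<open>\<beta>\<close> is 1 at \<open>n = 0\<close> and 0 elsewhere, gives
  \<open>\<Sum>\<^sub>s theta_coeff q s * pole q x s\<close> as a product. Splitting \<open>pole\<close> into partial fractions and
  reflecting one of the halves turns this series into \<open>1 + x\<close> times the required one.\<close>

lemma kronecker_sum:
  assumes x: "x \<noteq> 0" "\<And>s. x * q powi s \<noteq> 1" "x \<noteq> -1"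
  shows "(\<Sum>\<^sub>\<infinity>s. theta_coeff q s * q powi s / (1 - x * q powi s))
    = (qpoch_inf q q)\<^sup>2 / (qpoch_inf x q * qpoch_inf (q / x) q)"
proof -
  define A where "A = (\<Sum>\<^sub>\<infinity>s. theta_coeff q s * q powi s / (1 - x * q powi s))"
  define P where "P = (\<Sum>\<^sub>\<infinity>s. theta_coeff q s * pole q x s)"
  have nz: "1 - x * q powi s \<noteq> 0" "1 - q powi s / x \<noteq> 0" for s
    using x(2)[of s] x(2)[of "-s"] x(1) by (auto simp: power_int_minus field_simps)
  have x1: "x \<noteq> 1" using x(2)[of 0] by simp
  have s0: "theta_coeff q summable_on UNIV" using summable_theta_coeff[of 1 UNIV] by simp
  obtain B where B: "\<And>s. norm (1 / (1 - x * q powi s)) \<le> B"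
    using bounded_inverse_one_minus[OF x(1) nz(1)] by blast
  have sA: "(\<lambda>s. theta_coeff q s * q powi s / (1 - x * q powi s)) summable_on UNIV"
    using summable_bounded_times_theta_coeff[of q UNIV "\<lambda>s. 1 / (1 - x * q powi s)" B] B by simp
  have delta: "(\<lambda>n. qpoch x q n * qpoch (inverse x) q n * q ^ n * (if n = 0 then 1 else 0)) sums
     (qpoch_inf x q * qpoch_inf (inverse x) q / (qpoch_inf q q)\<^sup>2 * P)"
    unfolding P_def
  proof (rule bailey_sum[OF x(1,2) s0])
    fix n :: nat
    show "(if n = 0 then 1 else 0) = (\<Sum>\<^sub>\<infinity>s. theta_coeff q s * (inv_qfact q (int n - s) * inv_qfact q (int n + s)))"
      using jacobi_sum_eq[of 1 n] by (simp add: jacobi_sum_def qpoch_one split: if_splits)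
  qed
  have "(\<lambda>n. qpoch x q n * qpoch (inverse x) q n * q ^ n * (if n = 0 then 1 else 0)) sums 1"
    using sums_single[of 0 "\<lambda>n. qpoch x q n * qpoch (inverse x) q n * q ^ n"]
    by (simp add: if_distrib mult.commute cong: if_cong)
  then have 1: "qpoch_inf x q * qpoch_inf (inverse x) q / (qpoch_inf q q)\<^sup>2 * P = 1"
    using delta sums_unique2 by blast
  \<comment> \<open>\<open>(x - 1/x) * pole = 1 / (1 - x q\<^sup>s) - 1 / (1 - q\<^sup>s / x)\<close>; the theta series at 1 vanishes.\<close>
  have P: "(x - inverse x) * P = (1 + x) * A"
  proof -
    have s1: "(\<lambda>s. theta_coeff q s + x * (theta_coeff q s * q powi s / (1 - x * q powi s))) summable_on UNIV"
      by (intro summable_on_add summable_on_cmult_right s0 sA)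
    have s2: "(\<lambda>s. theta_coeff q (- s) - theta_coeff q s * q powi s / (1 - x * q powi s)) summable_on UNIV"
      using s0 summable_on_reindex_bij_witness[of UNIV uminus uminus UNIV "theta_coeff q" "\<lambda>s. theta_coeff q (- s)"]
      by (intro summable_on_minus sA) auto
    have s3: "(\<lambda>s. theta_coeff q s / (1 - q powi s / x)) summable_on UNIV"
    proof -
      have "(\<lambda>s. theta_coeff q s / (1 - q powi s / x)) summable_on UNIV \<longleftrightarrow>
        (\<lambda>s. theta_coeff q (- s) - theta_coeff q s * q powi s / (1 - x * q powi s)) summable_on UNIV"
      proof (rule summable_on_reindex_bij_witness[of _ uminus uminus])
        fix s :: int
        show "theta_coeff q (- (- s)) - theta_coeff q (- s) * q powi (- s) / (1 - x * q powi (- s)) = theta_coeff q s / (1 - q powi s / x)"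
          using nz(1)[of "-s"] nz(2)[of s] x(1)
          by (simp add: theta_coeff_minus power_int_minus divide_simps) (simp add: algebra_simps)
      qed auto
      then show ?thesis using s2 by blast
    qed
    have "(x - inverse x) * P = (\<Sum>\<^sub>\<infinity>s. (x - inverse x) * (theta_coeff q s * pole q x s))"
      unfolding P_def by (simp add: infsum_cmult_right')
    also have "\<dots> = (\<Sum>\<^sub>\<infinity>s. (theta_coeff q s + x * (theta_coeff q s * q powi s / (1 - x * q powi s)))
        - theta_coeff q s / (1 - q powi s / x))"
    proof (rule infsum_cong)
      fix s
      show "(x - inverse x) * (theta_coeff q s * pole q x s)
        = (theta_coeff q s + x * (theta_coeff q s * q powi s / (1 - x * q powi s))) - theta_coeff q s / (1 - q powi s / x)"
        unfolding pole_def using nz[of s] x(1) by (simp add: divide_simps) (simp add: algebra_simps)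
    qed
    also have "\<dots> = (\<Sum>\<^sub>\<infinity>s. theta_coeff q s + x * (theta_coeff q s * q powi s / (1 - x * q powi s)))
        - (\<Sum>\<^sub>\<infinity>s. theta_coeff q s / (1 - q powi s / x))"
      by (rule infsum_minus[OF s1 s3])
    also have "(\<Sum>\<^sub>\<infinity>s. theta_coeff q s + x * (theta_coeff q s * q powi s / (1 - x * q powi s))) = x * A"
      unfolding infsum_add[OF s0 summable_on_cmult_right[OF sA]] infsum_cmult_right'
      by (simp add: infsum_theta_coeff_zero A_def)
    also have "(\<Sum>\<^sub>\<infinity>s. theta_coeff q s / (1 - q powi s / x)) = (\<Sum>\<^sub>\<infinity>s. theta_coeff q (-s) / (1 - q powi (-s) / x))"
      by (rule infsum_int_minus[symmetric])
    also have "\<dots> = (\<Sum>\<^sub>\<infinity>s. theta_coeff q (- s) - theta_coeff q s * q powi s / (1 - x * q powi s))"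
    proof (rule infsum_cong)
      fix s
      show "theta_coeff q (-s) / (1 - q powi (-s) / x) = theta_coeff q (- s) - theta_coeff q s * q powi s / (1 - x * q powi s)"
        using nz(1)[of s] nz(2)[of "-s"] x(1)
        by (simp add: theta_coeff_minus power_int_minus divide_simps) (simp add: algebra_simps)
    qed
    also have "\<dots> = (\<Sum>\<^sub>\<infinity>s. theta_coeff q (- s)) - A"
      unfolding A_def using s0 summable_on_reindex_bij_witness[of UNIV uminus uminus UNIV "theta_coeff q" "\<lambda>s. theta_coeff q (- s)"]
      by (intro infsum_minus sA) auto
    also have "(\<Sum>\<^sub>\<infinity>s. theta_coeff q (- s)) = 0"
      using infsum_int_minus[of "theta_coeff q"] by (simp add: infsum_theta_coeff_zero)
    finally show ?thesis by (simp add: algebra_simps)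
  qed
  have "A = (x - 1) / x * P"
  proof -
    have "1 + x \<noteq> 0" using x(3) by (metis add.inverse_unique)
    moreover have "(x - inverse x) * P = (1 + x) * ((x - 1) / x * P)"
      using x(1) by (simp add: field_simps)
    ultimately show ?thesis using P by (metis mult_left_cancel)
  qed
  moreover have "qpoch_inf (inverse x) q = (1 - inverse x) * qpoch_inf (q / x) q"
    using qpoch_inf_shift[of "inverse x"] by (simp add: divide_inverse)
  moreover have "(x - 1) / x = 1 - inverse x" using x(1) by (simp add: field_simps)
  ultimately have "A * (qpoch_inf x q * qpoch_inf (q / x) q) = qpoch_inf x q * qpoch_inf (inverse x) q * P"
    by (simp add: mult_ac)
  also have "\<dots> = (qpoch_inf q q)\<^sup>2" using 1 by (simp add: divide_simps mult_ac split: if_splits)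
  finally have "A * (qpoch_inf x q * qpoch_inf (q / x) q) = (qpoch_inf q q)\<^sup>2" .
  moreover have "qpoch_inf x q * qpoch_inf (q / x) q \<noteq> 0"
    using calculation by auto
  ultimately show ?thesis unfolding A_def[symmetric] by (simp add: field_simps)
qed

end

section \<open>Theta and Lambert series on residue classes\<close>

text \<open>The modulus \<open>l\<close> is odd, and \<open>h\<close> is the residue class fixed by the reflection \<open>s \<mapsto> 1 - s\<close>
  of the theta coefficients.\<close>

locale dissection = nome +
  fixes l h :: int
  assumes l_eq: "l = 2 * h - 1" and h_ge: "h \<ge> 2"
begin

lemma l_pos: "l > 0" using l_eq h_ge by simp

definition residue_class :: "int \<Rightarrow> int set" where
  "residue_class c = {s. s mod l = c mod l}"

lemma residue_class_iff: "s \<in> residue_class c \<longleftrightarrow> l dvd s - c"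
  by (auto simp: residue_class_def mod_eq_dvd_iff)

lemma residue_class_add: "r \<in> residue_class a \<Longrightarrow> s \<in> residue_class b \<Longrightarrow> r + s \<in> residue_class (a + b)"
  unfolding residue_class_def by (auto intro: mod_add_cong)

lemma residue_class_diff: "r \<in> residue_class a \<Longrightarrow> s \<in> residue_class b \<Longrightarrow> r - s \<in> residue_class (a - b)"
  unfolding residue_class_def by (auto intro: mod_diff_cong)

lemma residue_class_self: "l \<in> residue_class 0" "c \<in> residue_class c"
  by (simp_all add: residue_class_def)

lemma residue_class_reflect: "a - s \<in> residue_class (a - c) \<longleftrightarrow> s \<in> residue_class c"
  using dvd_diff_commute[of l s c] by (simp add: residue_class_iff)

lemma residue_class_minus: "- s \<in> residue_class c \<longleftrightarrow> s \<in> residue_class (- c)"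
  using residue_class_reflect[of 0 s "- c"] by simp

lemma nonzero_in_residue_class: "s \<in> residue_class b \<Longrightarrow> \<not> l dvd b \<Longrightarrow> \<not> l dvd s"
  by (auto simp: residue_class_def dvd_eq_mod_eq_0)

text \<open>The whole theta series vanishes at \<open>x = 1\<close>, but its part on one residue class is, up to a
  monomial, an infinite product; see \<open>theta_product\<close>.\<close>

definition theta :: "int \<Rightarrow> complex" where
  "theta c = (\<Sum>\<^sub>\<infinity>s\<in>residue_class c. theta_coeff q s)"

text \<open>Up to a monomial, these are bilateral series of the form that the theorem uses; see
  \<open>lambert_eq_bilat\<close>.\<close>

definition lambert :: "int \<Rightarrow> int \<Rightarrow> complex" where
  "lambert b i = (\<Sum>\<^sub>\<infinity>s\<in>residue_class b. theta_coeff q s * q powi (i * s) / (1 - q powi (l * s)))"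

lemma theta_mod: "theta c = theta (c mod l)"
  by (simp add: theta_def residue_class_def)

lemma lambert_mod: "lambert c i = lambert (c mod l) i"
  by (simp add: lambert_def residue_class_def)

lemma theta_reflect: "theta (1 - c) = - theta c"
proof -
  have "theta (1 - c) = (\<Sum>\<^sub>\<infinity>s\<in>residue_class c. theta_coeff q (1 - s))"
    unfolding theta_def
    by (rule infsum_reindex_bij_witness[of _ "\<lambda>s. 1 - s" "\<lambda>s. 1 - s"])
       (use residue_class_reflect[of 1 _ c] residue_class_reflect[of 1 _ "1 - c"] in simp_all)
  then show ?thesis by (simp add: theta_coeff_reflect infsum_uminus theta_def)
qed

text \<open>The class of \<open>h\<close> is mapped to itself by \<open>s \<mapsto> 1 - s\<close>, which changes the sign of each term.\<close>

lemma theta_h: "theta h = 0"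
proof -
  have "1 - h = h + l * (- 1)" by (simp add: l_eq)
  then have "theta (1 - h) = theta h" using theta_mod[of "1 - h"] theta_mod[of h] by (metis mod_mult_self2)
  then show ?thesis using theta_reflect[of h] by simp
qed

lemma lambert_reflect:
  assumes "\<not> l dvd b"
  shows "lambert (- b) i = - lambert b (l + 1 - i)"
proof -
  have "lambert (- b) i = (\<Sum>\<^sub>\<infinity>s\<in>residue_class b. theta_coeff q (- s) * q powi (i * (- s)) / (1 - q powi (l * (- s))))"
    unfolding lambert_def
    by (rule infsum_reindex_bij_witness[of _ uminus uminus])
       (simp_all add: residue_class_minus)
  also have "\<dots> = (\<Sum>\<^sub>\<infinity>s\<in>residue_class b. - (theta_coeff q s * q powi ((l + 1 - i) * s) / (1 - q powi (l * s))))"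
  proof (rule infsum_cong)
    fix s assume "s \<in> residue_class b"
    then have "s \<noteq> 0" using assms by (auto simp: residue_class_iff)
    then have "1 - q powi (l * s) \<noteq> 0" using powi_eq_1_iff[of "l * s"] l_pos by auto
    moreover have "q powi ((l + 1 - i) * s) = q powi (l * s) * q powi s * q powi (- (i * s))"
      by (simp add: algebra_simps flip: power_int_add)
    ultimately show "theta_coeff q (- s) * q powi (i * (- s)) / (1 - q powi (l * (- s)))
      = - (theta_coeff q s * q powi ((l + 1 - i) * s) / (1 - q powi (l * s)))"
      by (simp add: theta_coeff_minus power_int_minus divide_simps) (simp add: algebra_simps)
  qed
  finally show ?thesis by (simp add: infsum_uminus lambert_def)
qed

lemma theta_coeff_summable: "theta_coeff q summable_on A"
  using summable_theta_coeff[of 1 A] by simp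

lemma lambert_summable:
  assumes "\<not> l dvd b"
  shows "(\<lambda>s. theta_coeff q s * q powi (i * s) / (1 - q powi (l * s))) summable_on residue_class b"
proof -
  have "(\<lambda>s. theta_coeff q s * (q powi i) powi s * (1 / (1 - q powi (l * s)))) summable_on residue_class b"
  proof (rule summable_bounded_times_theta_coeff)
    fix s assume "s \<in> residue_class b"
    then have "l * s \<noteq> 0" using assms l_pos by (auto simp: residue_class_iff)
    then show "norm (1 / (1 - q powi (l * s))) \<le> 1 / (1 - norm q)"
      by (rule norm_inverse_one_minus_powi)
  qed simp
  then show ?thesis by (simp add: power_int_mult)
qed

text \<open>The coefficient of \<open>theta_coeff q \<sigma>\<close> in \<open>theta (a + i) * lambert b i\<close> when the terms are collected
  according to the sum \<open>\<sigma>\<close> of the two indices. It depends on \<open>\<sigma>\<close> and \<open>i\<close> only through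
  \<open>k = \<sigma> - i\<close>.\<close>

definition \<Phi> :: "int \<Rightarrow> int \<Rightarrow> complex" where
  "\<Phi> b k = (\<Sum>\<^sub>\<infinity>s\<in>residue_class b. q powi (s * s - k * s) / (1 - q powi (l * s)))"

lemma theta_times_lambert:
  assumes b: "\<not> l dvd b"
  shows "((\<lambda>\<sigma>. theta_coeff q \<sigma> * \<Phi> b (\<sigma> - i)) has_sum theta (a + i) * lambert b i) (residue_class (a + b + i))"
    and "\<sigma> \<in> residue_class (a + b + i) \<Longrightarrow>
      (\<lambda>s. q powi (s * s - (\<sigma> - i) * s) / (1 - q powi (l * s))) summable_on residue_class b"
proof -
  define u where "u s = theta_coeff q s * q powi (i * s) / (1 - q powi (l * s))" for s
  have u: "u summable_on residue_class b" unfolding u_def by (rule lambert_summable[OF b])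
  \<comment> \<open>The double series converges absolutely, so it may be summed along the lines \<open>r + s = \<sigma>\<close>.\<close>
  have prod: "(\<lambda>(r, s). theta_coeff q r * u s) summable_on residue_class (a + i) \<times> residue_class b"
    by (rule summable_on_product[OF theta_coeff_summable u])
  have shifted: "theta_coeff q (\<sigma> - s) * u s = theta_coeff q \<sigma> * (q powi (s * s - (\<sigma> - i) * s) / (1 - q powi (l * s)))" for \<sigma> s
  proof -
    have "theta_coeff q (\<sigma> - s) * theta_coeff q s = theta_coeff q \<sigma> * q powi (- ((\<sigma> - s) * s))"
    proof -
      have "q powi ((\<sigma> - s) * s) * q powi (- ((\<sigma> - s) * s)) = 1"
        by (simp add: power_int_minus del: mult_minus_left minus_diff_eq)
      then show ?thesis using theta_coeff_add[of "\<sigma> - s" s] by (metis diff_add_cancel mult.assoc mult_1_right)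
    qed
    moreover have "q powi (- ((\<sigma> - s) * s)) * q powi (i * s) = q powi (s * s - (\<sigma> - i) * s)"
      by (simp add: algebra_simps flip: power_int_add)
    ultimately show ?thesis unfolding u_def by (metis (no_types, lifting) mult.assoc times_divide_eq_right)
  qed
  have shifted': "theta_coeff q (r + s) * q powi (s * s - (r + s - i) * s) / (1 - q powi (l * s)) = theta_coeff q r * u s" for r s
    using shifted[of "r + s" s] by (simp only: add_diff_cancel_right' times_divide_eq_right)
  let ?G = "\<lambda>(\<sigma>, s). theta_coeff q \<sigma> * (q powi (s * s - (\<sigma> - i) * s) / (1 - q powi (l * s)))"
  have reindex: "((\<lambda>(r, s). theta_coeff q r * u s) has_sum V) (residue_class (a + i) \<times> residue_class b)
      \<longleftrightarrow> (?G has_sum V) (residue_class (a + b + i) \<times> residue_class b)" for V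
  proof (rule has_sum_reindex_bij_witness[of _ "\<lambda>(\<sigma>, s). (\<sigma> - s, s)" "\<lambda>(r, s). (r + s, s)"])
    fix x assume "x \<in> residue_class (a + i) \<times> residue_class b"
    then show "(\<lambda>(r, s). (r + s, s)) x \<in> residue_class (a + b + i) \<times> residue_class b"
      using residue_class_add[of _ "a + i" _ b] by (auto simp: add_ac)
  next
    fix x assume "x \<in> residue_class (a + b + i) \<times> residue_class b"
    then show "(\<lambda>(\<sigma>, s). (\<sigma> - s, s)) x \<in> residue_class (a + i) \<times> residue_class b"
      using residue_class_diff[of _ "a + b + i" _ b] by auto
  qed (auto simp: shifted')
  have G: "(?G has_sum (\<Sum>\<^sub>\<infinity>x\<in>residue_class (a + i) \<times> residue_class b. (\<lambda>(r, s). theta_coeff q r * u s) x)) (residue_class (a + b + i) \<times> residue_class b)"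
    by (rule iffD1[OF reindex has_sum_infsum[OF prod]])
  also have "(\<Sum>\<^sub>\<infinity>x\<in>residue_class (a + i) \<times> residue_class b. (\<lambda>(r, s). theta_coeff q r * u s) x) = theta (a + i) * lambert b i"
    unfolding infsum_Sigma'_banach[OF prod, symmetric] infsum_cmult_right' infsum_cmult_left'
    by (simp add: theta_def lambert_def u_def[abs_def])
  finally have G': "(?G has_sum (theta (a + i) * lambert b i)) (residue_class (a + b + i) \<times> residue_class b)" .
  have inner: "(\<lambda>s. q powi (s * s - (\<sigma> - i) * s) / (1 - q powi (l * s))) summable_on residue_class b"
    if "\<sigma> \<in> residue_class (a + b + i)" for \<sigma>
  proof -
    have "(\<lambda>s. theta_coeff q \<sigma> * (q powi (s * s - (\<sigma> - i) * s) / (1 - q powi (l * s)))) summable_on residue_class b"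
      using summable_on_SigmaD1[OF has_sum_imp_summable[OF G'], of \<sigma>] that by simp
    then show ?thesis by (simp only: summable_on_cmult_right'[OF theta_coeff_nonzero])
  qed
  then show "\<sigma> \<in> residue_class (a + b + i) \<Longrightarrow>
      (\<lambda>s. q powi (s * s - (\<sigma> - i) * s) / (1 - q powi (l * s))) summable_on residue_class b" .
  show "((\<lambda>\<sigma>. theta_coeff q \<sigma> * \<Phi> b (\<sigma> - i)) has_sum theta (a + i) * lambert b i) (residue_class (a + b + i))"
  proof (rule has_sum_SigmaD[OF G'])
    fix \<sigma> assume "\<sigma> \<in> residue_class (a + b + i)"
    then show "((\<lambda>s. ?G (\<sigma>, s)) has_sum theta_coeff q \<sigma> * \<Phi> b (\<sigma> - i)) (residue_class b)"
      unfolding \<Phi>_def prod.case by (intro has_sum_cmult_right has_sum_infsum inner)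
  qed
qed

lemma \<Phi>_summable:
  assumes "\<not> l dvd b"
  shows "(\<lambda>s. q powi (s * s - k * s) / (1 - q powi (l * s))) summable_on residue_class b"
  using theta_times_lambert(2)[OF assms, of k "k - b" 0] by (simp add: residue_class_iff)

text \<open>Raising \<open>k\<close> by \<open>l\<close> adds a series in which the denominator has cancelled. The substitution
  \<open>s \<mapsto> k + l - s\<close> preserves its terms and exchanges the classes of \<open>b\<close> and \<open>b'\<close>, so that both
  sides change by the same amount.\<close>

lemma \<Phi>_step:
  assumes b: "\<not> l dvd b" "\<not> l dvd b'" and k: "k \<in> residue_class (b + b')"
  shows "\<Phi> b' (k + l) - \<Phi> b (k + l) = \<Phi> b' k - \<Phi> b k"
proof -
  \<comment> \<open>The difference of the numerators is \<open>1 - q powi (l * s)\<close> times the new one.\<close>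
  have step: "\<Phi> b (k + l) - \<Phi> b k = (\<Sum>\<^sub>\<infinity>s\<in>residue_class b. q powi (s * s - (k + l) * s))" if b: "\<not> l dvd b" for b
  proof -
    have "\<Phi> b (k + l) - \<Phi> b k = (\<Sum>\<^sub>\<infinity>s\<in>residue_class b. q powi (s * s - (k + l) * s) / (1 - q powi (l * s))
        - q powi (s * s - k * s) / (1 - q powi (l * s)))"
      unfolding \<Phi>_def by (rule infsum_minus[symmetric]) (rule \<Phi>_summable[OF b])+
    also have "\<dots> = (\<Sum>\<^sub>\<infinity>s\<in>residue_class b. q powi (s * s - (k + l) * s))"
    proof (rule infsum_cong)
      fix s assume "s \<in> residue_class b"
      then have "s \<noteq> 0" using b by (auto simp: residue_class_iff)
      then have "1 - q powi (l * s) \<noteq> 0" using powi_eq_1_iff[of "l * s"] l_pos by auto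
      moreover have "q powi (s * s - k * s) = q powi (s * s - (k + l) * s) * q powi (l * s)"
        by (simp add: algebra_simps flip: power_int_add)
      ultimately show "q powi (s * s - (k + l) * s) / (1 - q powi (l * s))
        - q powi (s * s - k * s) / (1 - q powi (l * s)) = q powi (s * s - (k + l) * s)"
        by (simp add: divide_simps) (simp add: algebra_simps)
    qed
    finally show ?thesis .
  qed
  have "(\<Sum>\<^sub>\<infinity>s\<in>residue_class b. q powi (s * s - (k + l) * s)) = (\<Sum>\<^sub>\<infinity>s\<in>residue_class b'. q powi (s * s - (k + l) * s))"
  proof (rule infsum_reindex_bij_witness[of _ "\<lambda>s. k + l - s" "\<lambda>s. k + l - s"])
    fix s assume "s \<in> residue_class b"
    then show "k + l - s \<in> residue_class b'" "q powi ((k + l - s) * (k + l - s) - (k + l) * (k + l - s)) = q powi (s * s - (k + l) * s)"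
      using residue_class_diff[OF residue_class_add[OF k residue_class_self(1)], of s b] by (simp_all add: algebra_simps)
  next
    fix s assume "s \<in> residue_class b'"
    then show "k + l - s \<in> residue_class b"
      using residue_class_diff[OF residue_class_add[OF k residue_class_self(1)], of s b'] by simp
  qed auto
  then show ?thesis using step[OF b(1)] step[OF b(2)] by (simp add: algebra_simps)
qed

lemma \<Phi>_difference_const:
  assumes b: "\<not> l dvd b" "\<not> l dvd b'" and k: "k \<in> residue_class (b + b')"
  shows "\<Phi> b' k - \<Phi> b k = \<Phi> b' (b + b') - \<Phi> b (b + b')"
proof -
  have nat: "\<Phi> b' (k + l * int n) - \<Phi> b (k + l * int n) = \<Phi> b' k - \<Phi> b k" if "k \<in> residue_class (b + b')" for k n
  proof (induction n)
    case (Suc n)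
    have "l * int n \<in> residue_class 0" by (simp add: residue_class_def)
    then have "k + l * int n \<in> residue_class (b + b')" using residue_class_add[OF that, of "l * int n" 0] by simp
    from \<Phi>_step[OF b this] Suc show ?case by (simp add: algebra_simps)
  qed simp
  obtain m where m: "k - (b + b') = l * m" using k by (auto simp: residue_class_iff)
  show ?thesis
  proof (cases "m \<ge> 0")
    case True
    then show ?thesis using nat[of "b + b'" "nat m"] m by (simp add: residue_class_iff algebra_simps)
  next
    case False
    then have "k + l * int (nat (- m)) = b + b'" using m by (simp add: algebra_simps)
    then show ?thesis using nat[OF k, of "nat (- m)"] by simp
  qed
qed

text \<open>Collected by the total index, the left-hand side is a theta series over the class of
  \<open>b + b' + i\<close> whose coefficients carry the factor \<open>\<Phi> b' k - \<Phi> b k\<close>. This factor is constant by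
  \<open>\<Phi>_difference_const\<close>, and its value involves \<open>b\<close> and \<open>b'\<close> only.\<close>

lemma theta_lambert_exchange_const:
  assumes b: "\<not> l dvd b" "\<not> l dvd b'"
  obtains D where "\<And>i. theta (b + i) * lambert b' i - theta (b' + i) * lambert b i = D * theta (b + b' + i)"
proof -
  let ?D = "\<Phi> b' (b + b') - \<Phi> b (b + b')"
  have "theta (b + i) * lambert b' i - theta (b' + i) * lambert b i = ?D * theta (b + b' + i)" for i
  proof -
    have "((\<lambda>\<sigma>. theta_coeff q \<sigma> * \<Phi> b' (\<sigma> - i) - theta_coeff q \<sigma> * \<Phi> b (\<sigma> - i)) has_sum
        (theta (b + i) * lambert b' i - theta (b' + i) * lambert b i)) (residue_class (b + b' + i))"
      using theta_times_lambert(1)[OF b(2), of i b] theta_times_lambert(1)[OF b(1), of i b']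
      by (intro has_sum_minus) (auto simp: add.commute add.left_commute)
    also have "?this \<longleftrightarrow> ((\<lambda>\<sigma>. theta_coeff q \<sigma> * ?D) has_sum
        (theta (b + i) * lambert b' i - theta (b' + i) * lambert b i)) (residue_class (b + b' + i))"
    proof (rule has_sum_cong)
      fix \<sigma> assume "\<sigma> \<in> residue_class (b + b' + i)"
      then have "\<sigma> - i \<in> residue_class (b + b')" by (simp add: residue_class_iff algebra_simps)
      from \<Phi>_difference_const[OF b this]
      show "theta_coeff q \<sigma> * \<Phi> b' (\<sigma> - i) - theta_coeff q \<sigma> * \<Phi> b (\<sigma> - i) = theta_coeff q \<sigma> * ?D"
        by (simp flip: right_diff_distrib)
    qed
    finally have "theta (b + i) * lambert b' i - theta (b' + i) * lambert b i = (\<Sum>\<^sub>\<infinity>\<sigma>\<in>residue_class (b + b' + i). theta_coeff q \<sigma> * ?D)"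
      by (simp add: infsumI)
    then show ?thesis by (simp add: infsum_cmult_left' theta_def mult.commute)
  qed
  then show ?thesis by (rule that)
qed

definition Q :: complex where "Q = q powi (l * l)"

lemma Q_nome: "nome Q"
proof
  show "norm Q < 1" unfolding Q_def
    using norm_powi_le[of "l * l"] l_pos norm_less by (simp add: zero_less_mult_iff)
qed (simp add: Q_def)

text \<open>On the multiples of \<open>l\<close> one finds theta coefficients for the base \<open>q ^ (l * l)\<close>; hence all
  products below have that base.\<close>

lemma theta_coeff_l_times: "theta_coeff q (l * n) = theta_coeff Q n * q powi (l * n * (h - 1))"
proof -
  have "2 * (l * n * (l * n - 1) div 2) = 2 * (l * l * (n * (n - 1) div 2) + l * n * (h - 1))"
    unfolding distrib_left two_times_triangular mult.left_commute[of 2 "l * l"]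
    by (simp add: algebra_simps l_eq)
  then have e: "l * n * (l * n - 1) div 2 = l * l * (n * (n - 1) div 2) + l * n * (h - 1)" by simp
  have "(-1 :: complex) powi (l * n) = (-1) powi n"
    by (simp add: l_eq power_int_mult power_int_diff)
  then show ?thesis
    unfolding theta_coeff_def e Q_def by (simp add: power_int_add power_int_mult mult_ac)
qed

lemma infsum_residue_class:
  fixes f :: "int \<Rightarrow> complex"
  shows "(\<Sum>\<^sub>\<infinity>s\<in>residue_class b. f s) = (\<Sum>\<^sub>\<infinity>n. f (l * n + b))"
  by (rule infsum_reindex_bij_witness[of _ "\<lambda>n. l * n + b" "\<lambda>s. (s - b) div l"])
     (use l_pos in \<open>auto simp: residue_class_iff\<close>)

lemma lambert_eq_bilat:
  "lambert b i = theta_coeff q b * q powi (i * b) * bilat (l * l) (l * (2 * b + 2 * i - 1)) (l * b) q"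
proof -
  have "theta_coeff q (l * n + b) * q powi (i * (l * n + b)) / (1 - q powi (l * (l * n + b)))
    = theta_coeff q b * q powi (i * b) * ((- 1) powi n * q powi ((l * l * n\<^sup>2 + l * (2 * b + 2 * i - 1) * n) div 2)
       / (1 - q powi (l * l * n + l * b)))" for n
  proof -
    have "2 * (l * l * (n * (n - 1) div 2) + l * n * (h - 1) + l * n * b + i * l * n)
        = l * l * n\<^sup>2 + l * (2 * b + 2 * i - 1) * n"
      unfolding distrib_left two_times_triangular mult.left_commute[of 2 "l * l"]
      by (simp add: algebra_simps l_eq power2_eq_square)
    then have e: "(l * l * n\<^sup>2 + l * (2 * b + 2 * i - 1) * n) div 2
        = l * l * (n * (n - 1) div 2) + l * n * (h - 1) + l * n * b + i * l * n" by presburger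
    have "theta_coeff q (l * n + b) = theta_coeff Q n * q powi (l * n * (h - 1)) * theta_coeff q b * q powi (l * n * b)"
      by (simp add: theta_coeff_add theta_coeff_l_times)
    moreover have "theta_coeff Q n = (-1) powi n * q powi (l * l * (n * (n - 1) div 2))"
      by (simp add: theta_coeff_def Q_def power_int_mult)
    ultimately show ?thesis
      unfolding e by (simp add: power_int_add distrib_left mult_ac)
  qed
  then show ?thesis
    unfolding lambert_def infsum_residue_class bilat_def by (simp flip: infsum_cmult_right')
qed

lemma theta_product:
  fixes c defines "x \<equiv> q powi (l * (c + h - 1))"
  shows "theta c = theta_coeff q c * (qpoch_inf x Q * qpoch_inf (Q / x) Q * qpoch_inf Q Q)"
proof -
  have "theta_coeff q (l * n + c) = theta_coeff q c * (theta_coeff Q n * x powi n)" for n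
    by (simp add: theta_coeff_add theta_coeff_l_times x_def algebra_simps flip: power_int_mult power_int_add)
  then have "theta c = theta_coeff q c * (\<Sum>\<^sub>\<infinity>n. theta_coeff Q n * x powi n)"
    unfolding theta_def infsum_residue_class by (simp add: infsum_cmult_right')
  then show ?thesis
    using nome.jacobi_triple_product[OF Q_nome, of x] by (simp add: x_def)
qed

text \<open>For \<open>i = h - b\<close> the remaining power of \<open>q\<close> in the summand is a power of \<open>Q\<close>, and the series is
  the one evaluated by \<open>kronecker_sum\<close>.\<close>

lemma lambert_product:
  fixes b defines "x \<equiv> q powi (l * b)"
  assumes b: "\<not> l dvd b"
  shows "lambert b (h - b) = theta_coeff q b * q powi ((h - b) * b) *
    ((qpoch_inf Q Q)\<^sup>2 / (qpoch_inf x Q * qpoch_inf (Q / x) Q))"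
proof -
  have xQ: "x * Q powi s = q powi (l * (l * s + b))" for s
    unfolding x_def Q_def by (simp add: algebra_simps flip: power_int_mult power_int_add)
  have nz: "x * Q powi s \<noteq> 1" for s
  proof -
    have "l * s + b \<noteq> 0"
    proof
      assume "l * s + b = 0"
      then have "b = l * (- s)" by simp
      then show False using b by simp
    qed
    then show ?thesis unfolding xQ powi_eq_1_iff using l_pos by simp
  qed
  have "norm x \<noteq> 1"
  proof -
    have "l * b \<noteq> 0" using b l_pos by auto
    then have "l * b > 0 \<or> l * b < 0" by linarith
    then show ?thesis unfolding x_def
      using norm_powi_le[of "l * b"] norm_powi_ge[of "l * b"] norm_less norm_pos
      by (auto simp: field_simps)
  qed
  then have "x \<noteq> -1" by auto
  have t: "theta_coeff q (l * n + b) * q powi ((h - b) * (l * n + b)) / (1 - q powi (l * (l * n + b)))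
    = theta_coeff q b * q powi ((h - b) * b) * (theta_coeff Q n * Q powi n / (1 - x * Q powi n))" for n
  proof -
    have "theta_coeff q (l * n + b) = theta_coeff Q n * q powi (l * n * (h - 1)) * theta_coeff q b * q powi (l * n * b)"
      by (simp add: theta_coeff_add theta_coeff_l_times)
    moreover have "q powi (l * n * (h - 1)) * q powi (l * n * b) * q powi ((h - b) * (l * n + b))
       = q powi ((h - b) * b) * Q powi n"
      unfolding Q_def by (simp add: l_eq algebra_simps flip: power_int_mult power_int_add)
    ultimately have "theta_coeff q (l * n + b) * q powi ((h - b) * (l * n + b))
        = theta_coeff q b * q powi ((h - b) * b) * (theta_coeff Q n * Q powi n)"
      by (simp add: mult_ac)
    then show ?thesis unfolding xQ by simp
  qed
  show ?thesis
    unfolding lambert_def infsum_residue_class t infsum_cmult_right'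
    using nome.kronecker_sum[OF Q_nome _ nz \<open>x \<noteq> -1\<close>] by (simp add: x_def)
qed

definition \<kappa> :: complex where "\<kappa> = theta_coeff q h * qpoch_inf Q Q ^ 3"

text \<open>None of the factors of the triple product vanishes unless \<open>c\<close> is in the class of \<open>h\<close>.\<close>

lemma theta_nonzero:
  assumes "\<not> l dvd c - h"
  shows "theta c \<noteq> 0"
proof -
  interpret Q: nome Q by (rule Q_nome)
  define x where "x = q powi (l * (c + h - 1))"
  have x: "x * Q powi s \<noteq> 1" for s
  proof -
    have "c + h - 1 + l * s \<noteq> 0"
    proof
      assume "c + h - 1 + l * s = 0"
      then have "c - h = l * (- s - 1)" by (simp add: l_eq algebra_simps)
      then show False using assms by simp
    qed
    then have "l * (c + h - 1 + l * s) \<noteq> 0" using l_pos by simp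
    moreover have "x * Q powi s = q powi (l * (c + h - 1 + l * s))"
      unfolding x_def Q_def by (simp add: algebra_simps flip: power_int_mult power_int_add)
    ultimately show ?thesis by (simp only: powi_eq_1_iff not_False_eq_True)
  qed
  have "qpoch_inf x Q \<noteq> 0"
    by (rule Q.qpoch_inf_nonzero) (metis x power_int_of_nat)
  moreover have "qpoch_inf (Q / x) Q \<noteq> 0"
  proof (rule Q.qpoch_inf_nonzero)
    fix j
    show "Q / x * Q ^ j \<noteq> 1"
    proof
      assume "Q / x * Q ^ j = 1"
      then have "x = Q ^ Suc j" by (simp add: x_def field_simps)
      then have "x * Q powi (- int (Suc j)) = 1"
        by (simp only: power_int_minus power_int_of_nat) (simp add: field_simps)
      then show False using x by blast
    qed
  qed
  ultimately show ?thesis unfolding theta_product x_def[symmetric] by simp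
qed

lemma lambert_times_theta:
  assumes b: "\<not> l dvd b"
  shows "lambert b (h - b) * theta (b + h) = - \<kappa>"
proof -
  interpret Q: nome Q by (rule Q_nome)
  define x where "x = q powi (l * b)"
  have x0: "x \<noteq> 0" by (simp add: x_def)
  have "q powi (l * (b + h + h - 1)) = Q * x"
    unfolding x_def Q_def by (simp add: l_eq algebra_simps flip: power_int_add)
  then have theta: "theta (b + h) = theta_coeff q (b + h) * (qpoch_inf (Q * x) Q * qpoch_inf (inverse x) Q * qpoch_inf Q Q)"
    unfolding theta_product by (simp add: inverse_eq_divide)
  have "qpoch_inf x Q = (1 - x) * qpoch_inf (Q * x) Q"
    by (rule Q.qpoch_inf_shift)
  moreover have "qpoch_inf (inverse x) Q = (1 - inverse x) * qpoch_inf (Q / x) Q"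
    using Q.qpoch_inf_shift[of "inverse x"] by (simp add: divide_inverse)
  moreover have "A * ((1 - inverse x) * B) = - inverse x * ((1 - x) * A * B)" for A B
    using x0 by (simp add: field_simps)
  ultimately have th: "qpoch_inf (Q * x) Q * qpoch_inf (inverse x) Q
      = - inverse x * (qpoch_inf x Q * qpoch_inf (Q / x) Q)"
    by metis
  have nz: "theta (b + h) \<noteq> 0" by (rule theta_nonzero) (use b in simp)
  then have P: "qpoch_inf x Q * qpoch_inf (Q / x) Q \<noteq> 0"
    unfolding theta th by auto
  have e: "theta_coeff q b * q powi ((h - b) * b) * (theta_coeff q (b + h) * inverse x) = theta_coeff q h"
  proof -
    have "b * (b - 1) + (h - b) * b + b * h + - (l * b) = 0"
      unfolding l_eq by (simp add: algebra_simps)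
    then have "q powi (b * (b - 1)) * q powi ((h - b) * b) * q powi (b * h) * q powi (- (l * b)) = 1"
      by (simp only: power_int_add[symmetric] q_nonzero simp_thms power_int_0_right)
    moreover have "inverse x = q powi (- (l * b))" unfolding x_def by (rule power_int_minus[symmetric])
    moreover have "theta_coeff q b * q powi ((h - b) * b) * (theta_coeff q (b + h) * inverse x)
        = (theta_coeff q b * theta_coeff q b * q powi ((h - b) * b) * q powi (b * h) * inverse x) * theta_coeff q h"
      unfolding theta_coeff_add by (simp only: mult_ac)
    ultimately show ?thesis unfolding theta_coeff_square by (simp only: mult_1)
  qed
  have "A * (J\<^sup>2 / W) * (G * (- inverse x * W * J)) = - (A * (G * inverse x)) * J ^ 3"
    if "W \<noteq> 0" for A J W G
    using that by (simp add: power2_eq_square power3_eq_cube)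
  from this[OF P] have "lambert b (h - b) * theta (b + h)
      = - (theta_coeff q b * q powi ((h - b) * b) * (theta_coeff q (b + h) * inverse x)) * qpoch_inf Q Q ^ 3"
    unfolding lambert_product[OF b] theta th x_def[symmetric] .
  then show ?thesis unfolding e \<kappa>_def by simp
qed

text \<open>This is the relation between two Appell-Lerch sums whose parameters have the same quotient. The
  constant of \<open>theta_lambert_exchange_const\<close> is found from \<open>i = h - b\<close>, where the first product
  vanishes because \<open>theta h = 0\<close> and \<open>lambert b (h - b)\<close> is known by \<open>lambert_times_theta\<close>.\<close>

theorem theta_lambert_exchange:
  assumes b: "\<not> l dvd b" "\<not> l dvd b'"
  shows "theta (b + i) * lambert b' i - theta (b' + i) * lambert b i
    = \<kappa> * theta (b' - b + h) * theta (b + b' + i) / (theta (b + h) * theta (b' + h))"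
proof -
  obtain D where D: "\<And>i. theta (b + i) * lambert b' i - theta (b' + i) * lambert b i = D * theta (b + b' + i)"
    using theta_lambert_exchange_const[OF b] by blast
  have nz: "theta (b + h) \<noteq> 0" "theta (b' + h) \<noteq> 0" by (rule theta_nonzero; use b in simp)+
  have "D * theta (b' + h) = - theta (b' - b + h) * lambert b (h - b)"
    using D[of "h - b"] by (simp add: theta_h algebra_simps)
  also have "lambert b (h - b) = - \<kappa> / theta (b + h)"
    using lambert_times_theta[OF b(1)] nz by (simp add: field_simps)
  finally have "D = \<kappa> * theta (b' - b + h) / (theta (b + h) * theta (b' + h))"
    using nz by (simp add: field_simps)
  then show ?thesis unfolding D by simp
qed

section \<open>Specialization to roots of unity\<close>

lemma sum_over_classes:
  fixes f :: "int \<Rightarrow> complex"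
  assumes "\<And>b. b \<in> {0..<l} \<Longrightarrow> (f has_sum v b) (residue_class b)"
  shows "(f has_sum (\<Sum>b\<in>{0..<l}. v b)) UNIV"
proof -
  have "(f has_sum (\<Sum>b\<in>{0..<l}. v b)) (\<Union>b\<in>{0..<l}. residue_class b)"
    by (rule sum_has_sum) (use assms in \<open>auto simp: residue_class_def\<close>)
  moreover have "(\<Union>b\<in>{0..<l}. residue_class b) = UNIV"
    using l_pos by (auto simp: residue_class_def intro!: bexI[of _ "_ mod l"])
  ultimately show ?thesis by simp
qed

lemma theta_dissection:
  assumes \<rho>: "\<rho> \<noteq> 0" "\<rho> powi l = 1"
  shows "qpoch_inf \<rho> q * qpoch_inf (q / \<rho>) q * qpoch_inf q q = (\<Sum>b\<in>{0..<l}. \<rho> powi b * theta b)"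
proof -
  have "((\<lambda>s. theta_coeff q s * \<rho> powi s) has_sum (\<Sum>b\<in>{0..<l}. \<rho> powi b * theta b)) UNIV"
  proof (rule sum_over_classes)
    fix b
    have "((\<lambda>s. theta_coeff q s * \<rho> powi b) has_sum theta b * \<rho> powi b) (residue_class b)"
      unfolding theta_def by (intro has_sum_cmult_left has_sum_infsum theta_coeff_summable)
    also have "?this \<longleftrightarrow> ((\<lambda>s. theta_coeff q s * \<rho> powi s) has_sum theta b * \<rho> powi b) (residue_class b)"
    proof (rule has_sum_cong)
      fix s assume "s \<in> residue_class b"
      then obtain m where "s = b + l * m" by (auto simp: residue_class_iff dvd_def algebra_simps)
      then show "theta_coeff q s * \<rho> powi b = theta_coeff q s * \<rho> powi s"
        using \<rho> by (simp add: power_int_add power_int_mult)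
    qed
    finally show "((\<lambda>s. theta_coeff q s * \<rho> powi s) has_sum \<rho> powi b * theta b) (residue_class b)" by (simp add: mult.commute)
  qed
  then show ?thesis using jacobi_triple_product[OF \<rho>(1)] by (simp add: infsumI)
qed

text \<open>The weight \<open>k\<close> is constant on residue classes and vanishes on the class of 0, the only one
  that contains a zero of \<open>1 - q powi (l * s)\<close>.\<close>

lemma lambert_dissection:
  assumes I: "finite I"
    and k: "\<And>s. k (s + l) = k s" "k 0 = 0"
    and p: "\<And>s. \<not> l dvd s \<Longrightarrow> p s = (\<Sum>i\<in>I. g i * q powi (i * s)) / (1 - q powi (l * s))"
  shows "(\<Sum>\<^sub>\<infinity>s. theta_coeff q s * q powi (e * s) * k s * p s) = (\<Sum>b\<in>{1..<l}. k b * (\<Sum>i\<in>I. g i * lambert b (i + e)))"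
proof -
  have kper: "k (s + l * m) = k s" for s m
  proof -
    have nat: "k (s + l * int n) = k s" for s n
    proof (induction n)
      case (Suc n)
      have "s + l * int (Suc n) = (s + l * int n) + l" by (simp add: algebra_simps)
      then show ?case by (simp only: k(1) Suc)
    qed simp
    show ?thesis
    proof (cases "m \<ge> 0")
      case True then show ?thesis using nat[of s "nat m"] by simp
    next
      case False then show ?thesis using nat[of "s + l * m" "nat (- m)"] by simp
    qed
  qed
  have "((\<lambda>s. theta_coeff q s * q powi (e * s) * k s * p s) has_sum
     (\<Sum>b\<in>{0..<l}. k b * (\<Sum>i\<in>I. g i * lambert b (i + e)))) UNIV"
  proof (rule sum_over_classes)
    fix b assume b: "b \<in> {0..<l}"
    have ks: "k s = k b" if "s \<in> residue_class b" for s
    proof -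
      from that obtain m where "s = b + l * m" by (auto simp: residue_class_iff dvd_def algebra_simps)
      then show ?thesis by (simp add: kper)
    qed
    show "((\<lambda>s. theta_coeff q s * q powi (e * s) * k s * p s) has_sum k b * (\<Sum>i\<in>I. g i * lambert b (i + e))) (residue_class b)"
    proof (cases "b = 0")
      case True
      have "((\<lambda>s. 0 :: complex) has_sum 0) (residue_class b)" by simp
      also have "?this \<longleftrightarrow> ((\<lambda>s. theta_coeff q s * q powi (e * s) * k s * p s) has_sum 0) (residue_class b)"
        by (rule has_sum_cong) (use ks True k(2) in auto)
      finally show ?thesis using True k(2) by simp
    next
      case False
      then have nd: "\<not> l dvd b" using b by (auto dest: zdvd_imp_le)
      have "((\<lambda>s. \<Sum>i\<in>I. g i * (theta_coeff q s * q powi ((i + e) * s) / (1 - q powi (l * s)))) has_sum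
          (\<Sum>i\<in>I. g i * lambert b (i + e))) (residue_class b)"
        using I
      proof (induction I rule: finite_induct)
        case (insert i I)
        have "((\<lambda>s. theta_coeff q s * q powi ((i + e) * s) / (1 - q powi (l * s))) has_sum lambert b (i + e)) (residue_class b)"
          unfolding lambert_def by (rule has_sum_infsum[OF lambert_summable[OF nd]])
        then show ?case
          unfolding sum.insert[OF insert.hyps] by (intro has_sum_add insert.IH has_sum_cmult_right)
      qed simp
      then have "((\<lambda>s. k b * (\<Sum>i\<in>I. g i * (theta_coeff q s * q powi ((i + e) * s) / (1 - q powi (l * s))))) has_sum
          k b * (\<Sum>i\<in>I. g i * lambert b (i + e))) (residue_class b)"
        by (rule has_sum_cmult_right)
      also have "?this \<longleftrightarrow> ?thesis"
      proof (rule has_sum_cong)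
        fix s assume s: "s \<in> residue_class b"
        have powi_i: "q powi ((i + e) * s) = q powi (i * s) * q powi (e * s)" for i
          by (simp add: distrib_right power_int_add)
        from s have "\<not> l dvd s" using nd by (rule nonzero_in_residue_class)
        from p[OF this] show "k b * (\<Sum>i\<in>I. g i * (theta_coeff q s * q powi ((i + e) * s) / (1 - q powi (l * s))))
           = theta_coeff q s * q powi (e * s) * k s * p s"
          unfolding ks[OF s] powi_i by (simp add: sum_distrib_left sum_divide_distrib mult_ac)
      qed
      finally show ?thesis .
    qed
  qed
  moreover have "(\<Sum>b\<in>{0..<l}. k b * (\<Sum>i\<in>I. g i * lambert b (i + e))) = (\<Sum>b\<in>{1..<l}. k b * (\<Sum>i\<in>I. g i * lambert b (i + e)))"
  proof -
    have "{0..<l} = insert 0 {1..<l}" using l_pos by auto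
    then show ?thesis using k(2) by simp
  qed
  ultimately show ?thesis by (simp add: infsumI)
qed

text \<open>Only \<open>q powi 0\<close> has absolute value 1.\<close>

lemma unit_times_powi_neq_1:
  assumes "norm x = 1" "x \<noteq> 1"
  shows "x * q powi s \<noteq> 1"
proof (cases s "0 :: int" rule: linorder_cases)
  case equal
  then show ?thesis using assms by simp
next
  case less
  have "1 < 1 / norm q" using norm_pos norm_less by simp
  also have "\<dots> \<le> norm (x * q powi s)" using norm_powi_ge[OF less] assms by (simp add: norm_mult)
  finally show ?thesis by auto
next
  case greater
  have "norm (x * q powi s) \<noteq> 1" using norm_powi_le[OF greater] norm_less assms by (simp add: norm_mult)
  then show ?thesis by auto
qed

text \<open>The polynomial with coefficients \<open>g\<close> is \<open>u\<close> times the product of the factors \<open>1 - u * \<omega>\<close> over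
  all \<open>n\<close>-th roots of unity \<open>\<omega>\<close> other than \<open>\<zeta>\<close> and \<open>1 / \<zeta>\<close>; it extends the fraction
  \<open>pole q \<zeta> s\<close> to the denominator \<open>1 - q powi (l * s)\<close>. The theta factor on the left comes from
  \<open>(\<rho>, 1/\<rho>, q; q)\<^sub>\<infinity>\<close>.\<close>

lemma RU_RV_dissection:
  fixes \<zeta> :: complex and n :: nat and g :: "int \<Rightarrow> complex"
  defines "\<rho> \<equiv> \<zeta>\<^sup>2"
  assumes n: "l = int n" and \<zeta>: "\<zeta> ^ n = 1" "\<zeta> \<noteq> 1" "\<rho> \<noteq> 1"
    and I: "finite I"
    and g: "\<And>u. u \<noteq> 0 \<Longrightarrow> (1 - \<zeta> * u) * (1 - u / \<zeta>) * (\<Sum>i\<in>I. g i * u powi i) = u * (1 - u ^ n)"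
  shows "RU \<zeta> q * ((1 + \<rho>) * (1 - inverse \<rho>) * (\<Sum>b\<in>{0..<l}. \<rho> powi b * theta b))
      = (\<Sum>b\<in>{1..<l}. spt_weight \<rho> b * (\<Sum>i\<in>I. g i * lambert b i))" (is ?U)
    and "RV \<zeta> q * ((1 + \<rho>) * (1 - inverse \<rho>) * (\<Sum>b\<in>{0..<l}. \<rho> powi b * theta b))
      = (\<Sum>b\<in>{1..<l}. spt_weight \<rho> b * (\<Sum>i\<in>I. g i * lambert b (i + 1)))" (is ?V)
    and "qpoch_inf \<rho> q * qpoch_inf (inverse \<rho>) q * qpoch_inf q q
      = (1 - inverse \<rho>) * (\<Sum>b\<in>{0..<l}. \<rho> powi b * theta b)"
    and "qpoch_inf \<rho> q * qpoch_inf (inverse \<rho>) q * qpoch_inf q q \<noteq> 0"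
proof -
  have n0: "n > 0" using n l_pos by simp
  have norm\<zeta>: "norm \<zeta> = 1" using power_eq_1_iff[OF \<zeta>(1)] n0 by simp
  have z0: "\<zeta> \<noteq> 0" using norm\<zeta> by auto
  have \<rho>0: "\<rho> \<noteq> 0" and norm\<rho>: "norm \<rho> = 1" using norm\<zeta> z0 by (auto simp: \<rho>_def norm_power)
  have \<zeta>l: "\<zeta> powi l = 1" using \<zeta>(1) n by simp
  have \<rho>l: "\<rho> powi l = 1"
    using \<zeta>(1) n by (simp add: \<rho>_def flip: power_mult) (simp add: mult.commute power_mult)
  have zq: "\<zeta> * q powi s \<noteq> 1" for s by (rule unit_times_powi_neq_1[OF norm\<zeta> \<zeta>(2)])
  have rq: "\<rho> * q powi s \<noteq> 1" for s by (rule unit_times_powi_neq_1[OF norm\<rho> \<zeta>(3)])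
  have shift: "qpoch_inf (inverse \<rho>) q = (1 - inverse \<rho>) * qpoch_inf (q / \<rho>) q"
    using qpoch_inf_shift[of "inverse \<rho>"] by (simp add: divide_inverse)
  show prod: "qpoch_inf \<rho> q * qpoch_inf (inverse \<rho>) q * qpoch_inf q q
      = (1 - inverse \<rho>) * (\<Sum>b\<in>{0..<l}. \<rho> powi b * theta b)"
    unfolding theta_dissection[OF \<rho>0 \<rho>l, symmetric] shift by (simp add: mult_ac)
  have "inverse \<rho> * q ^ j \<noteq> 1" "\<rho> * q ^ j \<noteq> 1" for j
    using rq[of "int j"] unit_times_powi_neq_1[of "inverse \<rho>" "int j"] norm\<rho> \<zeta>(3)
    by (auto simp: norm_inverse)
  then show "qpoch_inf \<rho> q * qpoch_inf (inverse \<rho>) q * qpoch_inf q q \<noteq> 0"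
    by (simp add: qpoch_inf_nonzero)
  have inv: "\<zeta> powi (- 2) = inverse \<rho>" by (simp add: \<rho>_def power_int_minus)
  have k: "spt_weight \<rho> (s + l) = spt_weight \<rho> s" "spt_weight \<rho> 0 = 0" for s
  proof -
    have "\<rho> powi (s + l + 1) = \<rho> powi (s + 1)"
      using \<rho>0 \<rho>l by (simp add: power_int_add mult_ac)
    moreover have "inverse \<rho> powi (s + l) = inverse \<rho> powi s"
      using \<rho>0 \<rho>l by (simp add: power_int_add power_int_inverse)
    ultimately show "spt_weight \<rho> (s + l) = spt_weight \<rho> s" by (simp add: spt_weight_def)
  qed (simp add: spt_weight_def)
  have p: "pole q \<zeta> s = (\<Sum>i\<in>I. g i * q powi (i * s)) / (1 - q powi (l * s))" if "\<not> l dvd s" for s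
  proof -
    define u where "u = q powi s"
    have u0: "u \<noteq> 0" by (simp add: u_def)
    have un: "u ^ n = q powi (l * s)" by (simp add: u_def n power_int_mult mult.commute)
    have "l * s \<noteq> 0" using that l_pos by auto
    then have nz: "1 - u ^ n \<noteq> 0" unfolding un using powi_eq_1_iff by auto
    have nz': "(1 - \<zeta> * u) * (1 - u / \<zeta>) \<noteq> 0"
      using g[OF u0] nz u0 by (metis mult_eq_0_iff)
    have "(\<Sum>i\<in>I. g i * q powi (i * s)) = (\<Sum>i\<in>I. g i * u powi i)"
      by (simp add: u_def mult.commute flip: power_int_mult)
    also have "\<dots> = u * (1 - u ^ n) / ((1 - \<zeta> * u) * (1 - u / \<zeta>))"
      using g[OF u0] nz' by (simp add: nonzero_eq_divide_eq mult_ac del: mult_eq_0_iff)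
    finally show ?thesis
      unfolding pole_def using nz by (simp add: flip: u_def un)
  qed
  have "RU \<zeta> q * ((1 + \<rho>) * (1 - inverse \<rho>) * (\<Sum>b\<in>{0..<l}. \<rho> powi b * theta b))
      = (\<Sum>\<^sub>\<infinity>s. theta_coeff q s * spt_weight \<rho> s * pole q \<zeta> s)"
    using F_expansion[OF z0 zq \<rho>0 rq] unfolding prod RU_def inv \<rho>_def[symmetric] by (simp only: mult_ac)
  also have "\<dots> = (\<Sum>b\<in>{1..<l}. spt_weight \<rho> b * (\<Sum>i\<in>I. g i * lambert b i))"
    using lambert_dissection[OF I k p, where e = 0] by simp
  finally show ?U .
  have "RV \<zeta> q * ((1 + \<rho>) * (1 - inverse \<rho>) * (\<Sum>b\<in>{0..<l}. \<rho> powi b * theta b))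
      = (\<Sum>\<^sub>\<infinity>s. theta_coeff q s * q powi s * spt_weight \<rho> s * pole q \<zeta> s)"
    using G_expansion[OF z0 zq \<rho>0 rq] unfolding prod RV_def inv \<rho>_def[symmetric] by (simp only: mult_ac)
  also have "\<dots> = (\<Sum>b\<in>{1..<l}. spt_weight \<rho> b * (\<Sum>i\<in>I. g i * lambert b (i + 1)))"
    using lambert_dissection[OF I k p, where e = 1] by simp
  finally show ?V .
qed

end

section \<open>Elimination for the moduli 5 and 7\<close>

text \<open>The final elimination for the modulus 5. The variable \<open>a\<close> is a root of \<open>x\<^sup>2 = x + 1\<close> in the field
  of fifth roots of unity, \<open>t0\<close> and \<open>t2\<close> are the two independent theta values, \<open>Sbi\<close> is the
  Lambert series of class \<open>b\<close> with exponent \<open>i\<close>, and the weights of the classes 1, 2, 3 are in the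
  proportion \<open>1 : a : 1\<close>.\<close>

lemma five_algebra:
  fixes a K t0 t2 :: complex
  assumes a: "a * a = a + 1" and t: "t0 \<noteq> 0" "t2 \<noteq> 0"
    and lambert: "S12 = K / t2" "S21 = - K / t0" "S11 = K * t0 / t2^2 - S31" "S13 = (K - t2 * S23) / t0"
      "S14 = - t0 * S22 / t2" "S24 = (t0 * S22 + K * t2^2 / t0^2) / t2"
      "S32 = - S24" "S33 = - S23" "S34 = - S22" "S25 = - S31" "S35 = - S21" "S15 = t0 * S31 / t2"
  shows "(S11 - a * S12 + a * S13 - S14) + a * (S21 - a * S22 + a * S23 - S24) + (S31 - a * S32 + a * S33 - S34)
     = (a * t2 - t0) * (- K / t2^2 - S23 / t0 - S22 / t2)"
    and "(S12 - a * S13 + a * S14 - S15) + a * (S22 - a * S23 + a * S24 - S25) + (S32 - a * S33 + a * S34 - S35)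
     = (a * t2 - t0) * (- K / (t0 * t2) + K / t0^2 + S31 / t2 - S33 / t0)"
  unfolding lambert using t apply (simp_all add: field_simps)
  subgoal using a by algebra
  subgoal using a by algebra
  done

text \<open>The same elimination for the modulus 7, where \<open>1\<close>, \<open>a\<close>, \<open>b\<close> is a basis of the real cubic
  subfield and the weights of the classes 1 to 5 are in the proportion \<open>1 : b : 1 - a : b : 1\<close>. The
  three theta values are not independent: they satisfy the equation of the Klein quartic.\<close>

lemma seven_algebra:
  fixes a b t0 t2 t3 K :: complex
  assumes ab: "a * a = b + 1" "a * b = a - b" "b * b = 1 - a + b"
    and t: "t0 \<noteq> 0" "t2 \<noteq> 0" "t3 \<noteq> 0"
    and klein: "t0 ^ 3 * t3 + t2 ^ 3 * t0 + t3 ^ 3 * t2 = 0"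
    and lambert: "S11 = K * t0^2 / (t2^2 * t3) - S51" "S21 = - K / t3 - S41" "S31 = - K / t0"
      "S12 = - S32 - K * t2^2 / (t0 * t3^2)" "S22 = K / t2" "S42 = t2 * S32 / t3 - K * t2 / t0^2"
      "S52 = - t0 * S32 / t3 + K / t0" "S62 = t0 * S32 / t3"
      "S13 = K / t3" "S23 = t3 * S33 / t2 - K * t3 / t2^2" "S43 = - t0 * S33 / t2 - K * t3^2 / (t0^2 * t2)"
      "S53 = t0 * S33 / t2" "S63 = - S33 + K / t2"
      "S14 = - t3 * S34 / t0 + K * t2 / (t0 * t3)" "S24 = - t2 * S34 / t0 - K * t3 / t0^2"
      "S54 = - S24" "S44 = - S34"
      "S15 = - S63" "S55 = - S23" "S16 = - S62" "S56 = - S22" "S25 = - S53" "S45 = - S33"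
      "S26 = - S52" "S46 = - S32" "S35 = - S43" "S36 = - S42"
  shows "(S11 + a * S12 + b * S13 - b * S14 - a * S15 - S16)
     + b * (S21 + a * S22 + b * S23 - b * S24 - a * S25 - S26)
     + (1 - a) * (S31 + a * S32 + b * S33 - b * S34 - a * S35 - S36)
     + b * (S41 + a * S42 + b * S43 - b * S44 - a * S45 - S46)
     + (S51 + a * S52 + b * S53 - b * S54 - a * S55 - S56)
     = - (t0 - b * t2 + a * t3) * (K * (- (t0 / (t3 * t2^2)) + (- a - b) / (t3 * t2) - 1 / (t3 * t0)
         + a / t2^2 + (1 - a - b) / t0^2) + (b - 1) * S34 / t0 - a * S33 / t2 - (1 - a - b) * S32 / t3)"
  unfolding lambert using t apply (simp add: field_simps)
  using ab klein by algebra

section \<open>The dissections\<close>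

lemma qtheta_single: "qtheta [x] q = qpoch_inf x q * qpoch_inf (q / x) q"
  by (simp add: qtheta_def)

text \<open>The last inequality excludes the fourth roots of unity; it makes \<open>1 + \<rho>\<close> invertible for
  \<open>\<rho> = z\<^sup>2\<close>.\<close>

lemma odd_primitive_root_of_unity:
  assumes "primitive_root_of_unity n z" and "odd n" and "n > 2"
  shows "z ^ n = 1" "z \<noteq> 1" "z\<^sup>2 \<noteq> 1" "(\<Sum>k<n. z ^ k) = 0" "1 + z\<^sup>2 \<noteq> 0"
proof -
  from assms(1) have p: "z ^ n = 1" and k: "\<And>k. 0 < k \<Longrightarrow> k < n \<Longrightarrow> z ^ k \<noteq> 1"
    by (auto simp: primitive_root_of_unity_def)
  show "z ^ n = 1" by (fact p)
  show z1: "z \<noteq> 1" and z2: "z\<^sup>2 \<noteq> 1" using k[of 1] k[of 2] assms(3) by auto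
  show "(\<Sum>k<n. z ^ k) = 0" using geometric_sum[OF z1, of n] p by simp
  show "1 + z\<^sup>2 \<noteq> 0"
  proof
    assume "1 + z\<^sup>2 = 0"
    then have sq: "z\<^sup>2 = - 1" by (simp add: add_eq_0_iff)
    obtain m where "n = 2 * m + 1" using assms(2) by (elim oddE)
    then have "z * (- 1) ^ m = 1" using p by (simp add: power_mult sq)
    then have "z\<^sup>2 = 1" by (cases "even m") (auto simp: minus_equation_iff[of z])
    then show False using z2 by simp
  qed
qed

lemma spt_weight_root_of_unity:
  assumes "z ^ n = 1" and "inverse (z\<^sup>2) = z ^ m"
  shows "spt_weight (z\<^sup>2) (int b) = z ^ (m * b mod n) + z ^ (2 * (b + 1) mod n) - 1 - z\<^sup>2"
proof -
  have reduce: "z ^ k = z ^ (k mod n)" for k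
  proof -
    have "z ^ k = z ^ (n * (k div n) + k mod n)" by simp
    also have "\<dots> = z ^ (k mod n)" unfolding power_add power_mult assms(1) by simp
    finally show ?thesis .
  qed
  have "spt_weight (z\<^sup>2) (int b) = z ^ (m * b) + z ^ (2 * (b + 1)) - 1 - z\<^sup>2"
    using assms(2) unfolding spt_weight_def power_mult
    by (metis of_nat_1 of_nat_add power_int_of_nat)
  then show ?thesis by (metis reduce)
qed

context nome begin

text \<open>The three numbers \<open>1\<close>, \<open>z\<close>, \<open>z\<^sup>2\<close> are the cube roots of unity, so corresponding factors multiply to
  \<open>1 - u ^ 3\<close>; the factor 3 is \<open>(1 - z) * (1 - z\<^sup>2)\<close>.\<close>

lemma cube_product:
  assumes z: "z ^ 3 = 1" "1 + z + z\<^sup>2 = 0"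
  shows "qpoch_inf (z\<^sup>2) q * qpoch_inf z q * qpoch_inf q q = 3 * qpoch_inf (q ^ 3) (q ^ 3)"
proof -
  interpret cube: nome "q ^ 3"
    by unfold_locales (use norm_pos norm_less in \<open>auto simp: norm_power power_less_one_iff\<close>)
  have finite: "qpoch (q * z\<^sup>2) q n * qpoch (q * z) q n * qpoch q q n = qpoch (q ^ 3) (q ^ 3) n" for n
    unfolding qpoch_def prod.distrib[symmetric]
  proof (rule prod.cong[OF refl])
    fix j
    define u where "u = q * q ^ j"
    have u3: "q ^ 3 * (q ^ 3) ^ j = u ^ 3" by (simp add: u_def power_mult_distrib mult.commute flip: power_mult)
    have "(1 - z\<^sup>2 * u) * (1 - z * u) * (1 - u) = 1 - u ^ 3" using z by algebra
    then show "(1 - q * z\<^sup>2 * q ^ j) * (1 - q * z * q ^ j) * (1 - q * q ^ j) = 1 - q ^ 3 * (q ^ 3) ^ j"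
      unfolding u3 by (simp add: u_def mult_ac)
  qed
  have "qpoch_inf (q * z\<^sup>2) q * qpoch_inf (q * z) q * qpoch_inf q q = qpoch_inf (q ^ 3) (q ^ 3)"
  proof (rule LIMSEQ_unique)
    show "(\<lambda>n. qpoch (q * z\<^sup>2) q n * qpoch (q * z) q n * qpoch q q n) \<longlonglongrightarrow>
        qpoch_inf (q * z\<^sup>2) q * qpoch_inf (q * z) q * qpoch_inf q q"
      by (intro tendsto_intros qpoch_tendsto)
    show "(\<lambda>n. qpoch (q * z\<^sup>2) q n * qpoch (q * z) q n * qpoch q q n) \<longlonglongrightarrow> qpoch_inf (q ^ 3) (q ^ 3)"
      unfolding finite by (rule cube.qpoch_tendsto)
  qed
  moreover have "(1 - z\<^sup>2) * (1 - z) = 3" using z by algebra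
  moreover have "qpoch_inf (z\<^sup>2) q * qpoch_inf z q * qpoch_inf q q
      = ((1 - z\<^sup>2) * (1 - z)) * (qpoch_inf (q * z\<^sup>2) q * qpoch_inf (q * z) q * qpoch_inf q q)"
    unfolding qpoch_inf_shift[of "z\<^sup>2"] qpoch_inf_shift[of z] by (simp only: mult_ac)
  ultimately show ?thesis by (simp only:)
qed

text \<open>The weight vanishes on the classes 0 and 2, so a single class remains and both formulas can be
  read off from \<open>RU_RV_dissection\<close>.\<close>

lemma dissection_3:
  assumes "primitive_root_of_unity 3 z"
  shows "RU z q = q^7 / qpoch_inf (q^3) (q^3) * bilat 9 27 6 q
       - q^5 / qpoch_inf (q^3) (q^3) * bilat 9 21 6 q" (is ?U)
    and "RV z q = - (q^3 / qpoch_inf (q^3) (q^3)) * bilat 9 15 6 q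
       + q^5 / qpoch_inf (q^3) (q^3) * bilat 9 21 6 q" (is ?V)
proof -
  interpret dissection q 3 2 by unfold_locales auto
  have "(\<Sum>k<3. z ^ k) = 1 + z + z\<^sup>2"
    by (simp add: eval_nat_numeral add_ac)
  then have z: "z ^ 3 = 1" "z \<noteq> 1" "z\<^sup>2 \<noteq> 1" "1 + z + z\<^sup>2 = 0" "1 + z\<^sup>2 \<noteq> 0"
    using odd_primitive_root_of_unity[OF assms] by simp_all
  have z0: "z \<noteq> 0" using z(1) by auto
  have invz: "inverse z = z\<^sup>2"
    using z0 z(1) by (intro inverse_unique) (simp add: power_Suc[symmetric] del: power_Suc)
  have inv\<rho>: "inverse (z\<^sup>2) = z"
    using z0 z(1) by (intro inverse_unique) (simp add: power_Suc2[symmetric] del: power_Suc)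
  define g :: "int \<Rightarrow> complex" where "g = (\<lambda>i. if i = 1 then 1 else - 1)"
  have g: "(1 - z * u) * (1 - u / z) * (\<Sum>i\<in>{1,2}. g i * u powi i) = u * (1 - u ^ 3)" for u
  proof -
    have "(1 - z * u) * (1 - z\<^sup>2 * u) * (u - u\<^sup>2) = u * (1 - u ^ 3)"
      using z(1,4) by algebra
    then show ?thesis by (simp add: g_def divide_inverse invz mult.commute)
  qed
  have range: "{0..<3} = {0, 1, 2 :: int}" "{1..<3} = {1, 2 :: int}" by auto
  define P where "P = qpoch_inf (q^3) (q^3)"
  define \<Theta> where "\<Theta> = (\<Sum>b\<in>{0..<3}. z\<^sup>2 powi b * theta b)"
  have "finite {1, 2 :: int}" "3 = int 3" by auto
  note main = RU_RV_dissection[OF this(2) z(1,2,3) this(1) g, folded \<Theta>_def]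
  have "1 + z\<^sup>2 = - z" using z(4) by algebra
  then have w: "spt_weight (z\<^sup>2) 1 = 3 * z" "spt_weight (z\<^sup>2) 2 = 0"
    using spt_weight_root_of_unity[OF z(1), of 1 1] spt_weight_root_of_unity[OF z(1), of 1 2] inv\<rho>
    by (simp_all add: algebra_simps power2_eq_square)
  have U: "RU z q * ((1 + z\<^sup>2) * (1 - inverse (z\<^sup>2)) * \<Theta>) = 3 * z * (lambert 1 1 - lambert 1 2)"
    unfolding main(1) range by (simp add: w g_def)
  have V: "RV z q * ((1 + z\<^sup>2) * (1 - inverse (z\<^sup>2)) * \<Theta>) = 3 * z * (lambert 1 2 - lambert 1 3)"
    unfolding main(2) range by (simp add: w g_def)
  have "(1 - inverse (z\<^sup>2)) * \<Theta> = 3 * P" "P \<noteq> 0"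
    using main(3,4) cube_product[OF z(1,4)] unfolding P_def inv\<rho> by auto
  then have \<Theta>: "(1 + z\<^sup>2) * (1 - inverse (z\<^sup>2)) * \<Theta> = - (3 * z * P)"
    using \<open>1 + z\<^sup>2 = - z\<close> by (simp add: mult.assoc)
  have S1: "lambert 1 i = - lambert 2 (4 - i)" for i
    using lambert_reflect[of 2 i] lambert_mod[of "-2" i] by simp
  have coeff2: "theta_coeff q 2 = q" by (simp add: theta_coeff_def)
  have S2: "lambert 2 3 = q ^ 7 * bilat 9 27 6 q" "lambert 2 2 = q ^ 5 * bilat 9 21 6 q" "lambert 2 1 = q ^ 3 * bilat 9 15 6 q"
    unfolding lambert_eq_bilat coeff2 by (simp_all flip: power_Suc)
  have "RU z q * P = lambert 2 3 - lambert 2 2"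
    using U[unfolded \<Theta>] z0 by (simp add: S1) algebra
  moreover have "RV z q * P = lambert 2 2 - lambert 2 1"
    using V[unfolded \<Theta>] z0 by (simp add: S1) algebra
  ultimately show ?U ?V
    using \<open>P \<noteq> 0\<close> unfolding P_def[symmetric] S2 by (simp_all add: field_simps)
qed

text \<open>The reflection and the exchange relation express all Lambert series that occur by \<open>lambert 2 2\<close>,
  \<open>lambert 2 3\<close>, \<open>lambert 3 1\<close> and theta values. Up to sign, these three series are those of the claim.\<close>

lemma dissection_5:
  assumes "primitive_root_of_unity 5 z"
  shows "RU z q =
       q * (qpoch_inf (q^25) (q^25) / (qtheta [q^5] (q^25))\<^sup>2)
       - q^7 / (qpoch_inf (q^25) (q^25) * qtheta [q^10] (q^25)) * bilat 25 45 10 q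
       - q^4 / (qpoch_inf (q^25) (q^25) * qtheta [q^5] (q^25)) * bilat 25 35 10 q" (is ?U)
    and "RV z q =
       - (q^5 / (qpoch_inf (q^25) (q^25) * qtheta [q^5] (q^25))) * bilat 25 35 15 q
       + q^12 / (qpoch_inf (q^25) (q^25) * qtheta [q^10] (q^25)) * bilat 25 55 15 q
       + q^2 * (qpoch_inf (q^25) (q^25) / qtheta [q^5, q^10] (q^25))
       - q^3 * (qpoch_inf (q^25) (q^25) / (qtheta [q^10] (q^25))\<^sup>2)" (is ?V)
proof -
  interpret dissection q 5 3 by unfold_locales auto
  have "(\<Sum>k<5. z ^ k) = 1 + z + z\<^sup>2 + z ^ 3 + z ^ 4"
    by (simp add: eval_nat_numeral add_ac)
  then have z: "z ^ 5 = 1" "z \<noteq> 1" "z\<^sup>2 \<noteq> 1" "1 + z + z\<^sup>2 + z ^ 3 + z ^ 4 = 0" "1 + z\<^sup>2 \<noteq> 0"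
    using odd_primitive_root_of_unity[OF assms] by simp_all
  define a where "a = 1 + z\<^sup>2 + z ^ 3"
  have z0: "z \<noteq> 0" using z(1) by auto
  have invz: "inverse z = z ^ 4"
    using z0 z(1) by (intro inverse_unique) (simp add: power_Suc[symmetric] del: power_Suc)
  have inv\<rho>: "inverse (z\<^sup>2) = z ^ 3"
    using z0 z(1) by (intro inverse_unique) (simp add: power_add[symmetric])
  define g :: "int \<Rightarrow> complex" where "g = (\<lambda>i. if i = 1 then 1 else if i = 2 then - a else if i = 3 then a else - 1)"
  have g: "(1 - z * u) * (1 - u / z) * (\<Sum>i\<in>{1,2,3,4}. g i * u powi i) = u * (1 - u ^ 5)" for u
  proof -
    have "(1 - z * u) * (1 - z ^ 4 * u) * (u - a * u\<^sup>2 + a * u ^ 3 - u ^ 4) = u * (1 - u ^ 5)"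
      using z(1,4) unfolding a_def by algebra
    then show ?thesis by (simp add: g_def divide_inverse invz mult.commute algebra_simps)
  qed
  have range: "{0..<5} = {0, 1, 2, 3, 4 :: int}" "{1..<5} = {1, 2, 3, 4 :: int}" by auto
  define \<Theta> where "\<Theta> = (\<Sum>b\<in>{0..<5}. z\<^sup>2 powi b * theta b)"
  have "finite {1, 2, 3, 4 :: int}" "5 = int 5" by auto
  note main = RU_RV_dissection[OF this(2) z(1,2,3) this(1) g, folded \<Theta>_def]
  have aa: "a * a = a + 1" using z(1,4) unfolding a_def by algebra
  define k where "k = z ^ 3 + z ^ 4 - 1 - z\<^sup>2"
  have w: "spt_weight (z\<^sup>2) 1 = k" "spt_weight (z\<^sup>2) 2 = a * k" "spt_weight (z\<^sup>2) 3 = k" "spt_weight (z\<^sup>2) 4 = 0"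
  proof -
    note w = spt_weight_root_of_unity[OF z(1) inv\<rho>]
    have w1: "spt_weight (z\<^sup>2) 1 = z ^ 3 + z ^ 4 - 1 - z\<^sup>2" using w[of 1] by simp
    have w2: "spt_weight (z\<^sup>2) 2 = z + z - 1 - z\<^sup>2" using w[of 2] by simp
    have w3: "spt_weight (z\<^sup>2) 3 = z ^ 4 + z ^ 3 - 1 - z\<^sup>2" using w[of 3] by simp
    have w4: "spt_weight (z\<^sup>2) 4 = z\<^sup>2 + 1 - 1 - z\<^sup>2" using w[of 4] by simp
    show "spt_weight (z\<^sup>2) 1 = k" "spt_weight (z\<^sup>2) 2 = a * k" "spt_weight (z\<^sup>2) 3 = k" "spt_weight (z\<^sup>2) 4 = 0"
      unfolding w1 w2 w3 w4 k_def a_def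
      subgoal by (simp add: add_ac)
      subgoal using z(1,4) by algebra
      subgoal by (simp add: add_ac)
      subgoal by (simp add: add_ac)
      done
  qed
  define t0 t2 where "t0 = theta 0" and "t2 = theta 2"
  have theta: "theta 0 = t0" "theta 1 = - t0" "theta 2 = t2" "theta 3 = 0" "theta 4 = - t2" "theta 5 = t0" "theta 6 = - t0" "theta 7 = t2" "theta 8 = 0" "theta 9 = - t2"
    using theta_reflect[of 0] theta_reflect[of 2] theta_h theta_mod[of "-1"] theta_mod[of 5] theta_mod[of 6] theta_mod[of 7] theta_mod[of 8] theta_mod[of 9]
    by (simp_all add: t0_def t2_def)
  have t: "t0 \<noteq> 0" "t2 \<noteq> 0"
    unfolding t0_def t2_def by (rule theta_nonzero; simp)+
  have lambert: "lambert 1 2 = \<kappa> / t2" "lambert 2 1 = - \<kappa> / t0" "lambert 1 1 = \<kappa> * t0 / t2^2 - lambert 3 1" "lambert 1 3 = (\<kappa> - t2 * lambert 2 3) / t0"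
      "lambert 1 4 = - t0 * lambert 2 2 / t2" "lambert 2 4 = (t0 * lambert 2 2 + \<kappa> * t2^2 / t0^2) / t2"
      "lambert 3 2 = - lambert 2 4" "lambert 3 3 = - lambert 2 3" "lambert 3 4 = - lambert 2 2" "lambert 2 5 = - lambert 3 1" "lambert 3 5 = - lambert 2 1" "lambert 1 5 = t0 * lambert 3 1 / t2"
  proof -
    have S3: "lambert 3 i = - lambert 2 (6 - i)" for i
      using lambert_reflect[of 2 i] lambert_mod[of "-2" i] by simp
    show "lambert 3 2 = - lambert 2 4" "lambert 3 3 = - lambert 2 3" "lambert 3 4 = - lambert 2 2" "lambert 2 5 = - lambert 3 1" "lambert 3 5 = - lambert 2 1"
      by (simp_all add: S3)
    show "lambert 1 2 = \<kappa> / t2" "lambert 2 1 = - \<kappa> / t0"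
      using lambert_times_theta[of 1] lambert_times_theta[of 2] t by (simp_all add: theta field_simps)
    show "lambert 1 1 = \<kappa> * t0 / t2^2 - lambert 3 1"
      using theta_lambert_exchange[of 1 3 1] t by (simp add: theta field_simps power2_eq_square)
    show "lambert 1 3 = (\<kappa> - t2 * lambert 2 3) / t0"
      using theta_lambert_exchange[of 1 3 3] t by (simp add: theta S3[of 3] field_simps)
    show "lambert 1 4 = - t0 * lambert 2 2 / t2"
      using theta_lambert_exchange[of 1 3 4] t by (simp add: theta S3[of 4] field_simps)
    show "lambert 2 4 = (t0 * lambert 2 2 + \<kappa> * t2^2 / t0^2) / t2"
      using theta_lambert_exchange[of 2 3 2] t by (simp add: theta S3[of 2] field_simps power2_eq_square)
    show "lambert 1 5 = t0 * lambert 3 1 / t2"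
      using theta_lambert_exchange[of 1 2 5] t by (simp add: theta S3[of 1] field_simps)
  qed
  note alg = five_algebra[OF aa t lambert]
  have \<Theta>: "(1 + z\<^sup>2) * (1 - inverse (z\<^sup>2)) * \<Theta> = k * (a * t2 - t0)"
  proof -
    have "\<Theta> = t0 - z\<^sup>2 * t0 + (z\<^sup>2) ^ 2 * t2 - (z\<^sup>2) ^ 4 * t2"
      unfolding \<Theta>_def range by (simp add: theta)
    then show ?thesis unfolding inv\<rho> k_def a_def using z(1,4) by algebra
  qed
  have nz: "k * (a * t2 - t0) \<noteq> 0"
    using main(3,4) z(5) unfolding \<Theta>[symmetric] by (simp add: mult.assoc)
  have "RU z q * (k * (a * t2 - t0)) = k * ((lambert 1 1 - a * lambert 1 2 + a * lambert 1 3 - lambert 1 4)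
      + a * (lambert 2 1 - a * lambert 2 2 + a * lambert 2 3 - lambert 2 4) + (lambert 3 1 - a * lambert 3 2 + a * lambert 3 3 - lambert 3 4))"
    unfolding \<Theta>[symmetric] main(1) range by (simp add: w g_def algebra_simps)
  also have "\<dots> = (- \<kappa> / t2^2 - lambert 2 3 / t0 - lambert 2 2 / t2) * (k * (a * t2 - t0))"
    unfolding alg(1) by (simp only: mult_ac)
  finally have U: "RU z q = - \<kappa> / t2^2 - lambert 2 3 / t0 - lambert 2 2 / t2" using nz by simp
  have "RV z q * (k * (a * t2 - t0)) = k * ((lambert 1 2 - a * lambert 1 3 + a * lambert 1 4 - lambert 1 5)
      + a * (lambert 2 2 - a * lambert 2 3 + a * lambert 2 4 - lambert 2 5) + (lambert 3 2 - a * lambert 3 3 + a * lambert 3 4 - lambert 3 5))"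
    unfolding \<Theta>[symmetric] main(2) range by (simp add: w g_def algebra_simps)
  also have "\<dots> = (- \<kappa> / (t0 * t2) + \<kappa> / t0^2 + lambert 3 1 / t2 - lambert 3 3 / t0) * (k * (a * t2 - t0))"
    unfolding alg(2) by (simp only: mult_ac)
  finally have V: "RV z q = - \<kappa> / (t0 * t2) + \<kappa> / t0^2 + lambert 3 1 / t2 - lambert 3 3 / t0" using nz by simp
  have theta_coeff: "theta_coeff q 0 = 1" "theta_coeff q 2 = q" "theta_coeff q 3 = - (q ^ 3)" by (simp_all add: theta_coeff_def)
  define J where "J = qpoch_inf (q^25) (q^25)"
  define \<theta>1 \<theta>2 where "\<theta>1 = qtheta [q^5] (q^25)" and "\<theta>2 = qtheta [q^10] (q^25)"
  have Q: "Q = q ^ 25" by (simp add: Q_def)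
  have pow: "q^25 / q^5 = q^20" "q^25 / q^20 = q^5" "q^25 / q^10 = q^15"
    by (simp_all add: divide_eq_eq flip: power_add)
  have t0: "t0 = \<theta>2 * J" and t2: "t2 = q * (\<theta>1 * J)"
    unfolding t0_def t2_def theta_product theta_coeff Q
    by (simp_all add: \<theta>1_def \<theta>2_def J_def qtheta_single pow)
  have \<kappa>: "\<kappa> = - (q ^ 3 * J ^ 3)" by (simp add: \<kappa>_def theta_coeff Q J_def)
  have Sb: "lambert 2 3 = q ^ 7 * bilat 25 45 10 q" "lambert 2 2 = q ^ 5 * bilat 25 35 10 q"
    "lambert 3 1 = - (q ^ 6 * bilat 25 35 15 q)" "lambert 3 3 = - (q ^ 12 * bilat 25 55 15 q)"
    unfolding lambert_eq_bilat theta_coeff by (simp_all flip: power_Suc power_add)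
  have nz: "J \<noteq> 0" "\<theta>1 \<noteq> 0" "\<theta>2 \<noteq> 0" using t by (auto simp: t0 t2)
  have prod: "qtheta [q^5, q^10] (q^25) = \<theta>1 * \<theta>2" by (simp add: \<theta>1_def \<theta>2_def qtheta_def)
  show ?U unfolding U t0 t2 \<kappa> Sb J_def[symmetric] \<theta>1_def[symmetric] \<theta>2_def[symmetric]
    using nz by (simp add: divide_simps) algebra
  show ?V unfolding V t0 t2 \<kappa> Sb prod J_def[symmetric] \<theta>1_def[symmetric] \<theta>2_def[symmetric]
    using nz by (simp add: divide_simps) algebra
qed

text \<open>Here the exchange relation leaves \<open>lambert 3 2\<close>, \<open>lambert 3 3\<close> and \<open>lambert 3 4\<close>. For \<open>i = 1\<close> it
  does not reach class 3, but then the series occur only in the pairs \<open>b\<close> and \<open>6 - b\<close>, and the sum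
  over such a pair is a quotient of theta values.\<close>

lemma dissection_7:
  assumes "primitive_root_of_unity 7 z"
  shows "RU z q =
       q * (qpoch_inf (q^49) (q^49) * qtheta [q^21] (q^49)
              / (qtheta [q^7] (q^49) * (qtheta [q^14] (q^49))\<^sup>2))
       - (z^2 + z^5) * (q^15 / (qpoch_inf (q^49) (q^49) * qtheta [q^21] (q^49))) * bilat 49 91 21 q
       - (z^3 + z^4) * q^2 * (qpoch_inf (q^49) (q^49) / qtheta [q^7, q^14] (q^49))
       + q^3 * (qpoch_inf (q^49) (q^49) / qtheta [q^7, q^21] (q^49))
       + (z + z^6) * q^4 * (qpoch_inf (q^49) (q^49) / (qtheta [q^14] (q^49))\<^sup>2)
       + (z + z^6) * (q^11 / (qpoch_inf (q^49) (q^49) * qtheta [q^14] (q^49))) * bilat 49 77 21 q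
       + (1 + z^3 + z^4) * q^6 * (qpoch_inf (q^49) (q^49) / (qtheta [q^21] (q^49))\<^sup>2)
       - (1 + z^3 + z^4) * (q^6 / (qpoch_inf (q^49) (q^49) * qtheta [q^7] (q^49))) * bilat 49 63 21 q"
proof -
  interpret dissection q 7 4 by unfold_locales auto
  have "(\<Sum>k<7. z ^ k) = 1 + z + z\<^sup>2 + z ^ 3 + z ^ 4 + z ^ 5 + z ^ 6"
    by (simp add: eval_nat_numeral add_ac)
  then have z: "z ^ 7 = 1" "z \<noteq> 1" "z\<^sup>2 \<noteq> 1" "1 + z + z\<^sup>2 + z ^ 3 + z ^ 4 + z ^ 5 + z ^ 6 = 0" "1 + z\<^sup>2 \<noteq> 0"
    using odd_primitive_root_of_unity[OF assms] by simp_all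
  define a b where "a = z + z ^ 6" and "b = 1 + z\<^sup>2 + z ^ 5"
  have z0: "z \<noteq> 0" using z(1) by auto
  have invz: "inverse z = z ^ 6"
    using z0 z(1) by (intro inverse_unique) (simp add: power_Suc[symmetric] del: power_Suc)
  have inv\<rho>: "inverse (z\<^sup>2) = z ^ 5"
    using z0 z(1) by (intro inverse_unique) (simp add: power_add[symmetric])
  define g :: "int \<Rightarrow> complex" where "g = (\<lambda>i. if i = 1 then 1 else if i = 2 then a else if i = 3 then b
    else if i = 4 then - b else if i = 5 then - a else - 1)"
  have g: "(1 - z * u) * (1 - u / z) * (\<Sum>i\<in>{1,2,3,4,5,6}. g i * u powi i) = u * (1 - u ^ 7)" for u
  proof -
    have "(1 - z * u) * (1 - z ^ 6 * u) * (u + a * u\<^sup>2 + b * u ^ 3 - b * u ^ 4 - a * u ^ 5 - u ^ 6) = u * (1 - u ^ 7)"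
      using z(1,4) unfolding a_def b_def by algebra
    then show ?thesis by (simp add: g_def divide_inverse invz mult.commute algebra_simps)
  qed
  have range: "{0..<7} = {0, 1, 2, 3, 4, 5, 6 :: int}" "{1..<7} = {1, 2, 3, 4, 5, 6 :: int}" by auto
  define \<Theta> where "\<Theta> = (\<Sum>b\<in>{0..<7}. z\<^sup>2 powi b * theta b)"
  have "finite {1, 2, 3, 4, 5, 6 :: int}" "7 = int 7" by auto
  note main = RU_RV_dissection[OF this(2) z(1,2,3) this(1) g, folded \<Theta>_def]
  have ab: "a * a = b + 1" "a * b = a - b" "b * b = 1 - a + b"
    using z(1,4) unfolding a_def b_def by algebra+
  define k where "k = z ^ 5 + z ^ 4 - 1 - z\<^sup>2"
  have w: "spt_weight (z\<^sup>2) 1 = k" "spt_weight (z\<^sup>2) 2 = b * k" "spt_weight (z\<^sup>2) 3 = (1 - a) * k"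
    "spt_weight (z\<^sup>2) 4 = b * k" "spt_weight (z\<^sup>2) 5 = k" "spt_weight (z\<^sup>2) 6 = 0"
  proof -
    note w = spt_weight_root_of_unity[OF z(1) inv\<rho>]
    have w1: "spt_weight (z\<^sup>2) 1 = z ^ 5 + z ^ 4 - 1 - z\<^sup>2" using w[of 1] by simp
    have w2: "spt_weight (z\<^sup>2) 2 = z ^ 3 + z ^ 6 - 1 - z\<^sup>2" using w[of 2] by simp
    have w3: "spt_weight (z\<^sup>2) 3 = z + z - 1 - z\<^sup>2" using w[of 3] by simp
    have w4: "spt_weight (z\<^sup>2) 4 = z ^ 6 + z ^ 3 - 1 - z\<^sup>2" using w[of 4] by simp
    have w5: "spt_weight (z\<^sup>2) 5 = z ^ 4 + z ^ 5 - 1 - z\<^sup>2" using w[of 5] by simp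
    have w6: "spt_weight (z\<^sup>2) 6 = z\<^sup>2 + 1 - 1 - z\<^sup>2" using w[of 6] by simp
    show "spt_weight (z\<^sup>2) 1 = k" "spt_weight (z\<^sup>2) 2 = b * k" "spt_weight (z\<^sup>2) 3 = (1 - a) * k" "spt_weight (z\<^sup>2) 4 = b * k" "spt_weight (z\<^sup>2) 5 = k" "spt_weight (z\<^sup>2) 6 = 0"
      unfolding w1 w2 w3 w4 w5 w6 k_def a_def b_def
      subgoal by (simp add: add_ac)
      subgoal using z(1,4) by algebra
      subgoal using z(1,4) by algebra
      subgoal using z(1,4) by algebra
      subgoal by (simp add: add_ac)
      subgoal by (simp add: add_ac)
      done
  qed
  define t0 t2 t3 where "t0 = theta 0" and "t2 = theta 2" and "t3 = theta 3"
  have theta: "theta 0 = t0" "theta 1 = - t0" "theta 2 = t2" "theta 3 = t3" "theta 4 = 0" "theta 5 = - t3" "theta 6 = - t2" "theta 7 = t0" "theta 8 = - t0"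
      "theta 9 = t2" "theta 10 = t3" "theta 11 = 0" "theta 12 = - t3"
    using theta_reflect[of 0] theta_reflect[of 2] theta_reflect[of 3] theta_h theta_mod[of "-1"] theta_mod[of "-2"] theta_mod[of 7] theta_mod[of 8]
      theta_mod[of 9] theta_mod[of 10] theta_mod[of 11] theta_mod[of 12]
    by (simp_all add: t0_def t2_def t3_def)
  have t: "t0 \<noteq> 0" "t2 \<noteq> 0" "t3 \<noteq> 0"
    unfolding t0_def t2_def t3_def by (rule theta_nonzero; simp)+
  have \<kappa>0: "\<kappa> \<noteq> 0"
    using nome.qpoch_inf_q_nonzero[OF Q_nome] by (simp add: \<kappa>_def)
  have lambert_neg: "lambert 4 i = - lambert 3 (8 - i)" "lambert 5 i = - lambert 2 (8 - i)" "lambert 6 i = - lambert 1 (8 - i)" for i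
    using lambert_reflect[of 3 i] lambert_reflect[of 2 i] lambert_reflect[of 1 i] lambert_mod[of "-3" i] lambert_mod[of "-2" i] lambert_mod[of "-1" i]
    by simp_all
  have lambert_refl: "lambert 5 4 = - lambert 2 4" "lambert 4 4 = - lambert 3 4"
      "lambert 1 5 = - lambert 6 3" "lambert 5 5 = - lambert 2 3" "lambert 1 6 = - lambert 6 2" "lambert 5 6 = - lambert 2 2" "lambert 2 5 = - lambert 5 3" "lambert 4 5 = - lambert 3 3"
      "lambert 2 6 = - lambert 5 2" "lambert 4 6 = - lambert 3 2" "lambert 3 5 = - lambert 4 3" "lambert 3 6 = - lambert 4 2"
    by (simp_all add: lambert_neg)
  have lambert_pair: "lambert 1 1 = \<kappa> * t0^2 / (t2^2 * t3) - lambert 5 1" "lambert 2 1 = - \<kappa> / t3 - lambert 4 1" "lambert 3 1 = - \<kappa> / t0"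
    using theta_lambert_exchange[of 1 5 1] theta_lambert_exchange[of 2 4 1] lambert_times_theta[of 3] t
    by (simp_all add: theta field_simps power2_eq_square)
  have lambert_12: "lambert 1 2 = - lambert 3 2 - \<kappa> * t2^2 / (t0 * t3^2)"
    using theta_lambert_exchange[of 3 1 2] t by (simp add: theta field_simps power2_eq_square eq_neg_iff_add_eq_0 neg_eq_iff_add_eq_0)
  have lambert_22: "lambert 2 2 = \<kappa> / t2"
    using theta_lambert_exchange[of 3 2 2] t by (simp add: theta field_simps power2_eq_square)
  have lambert_42: "lambert 4 2 = t2 * lambert 3 2 / t3 - \<kappa> * t2 / t0^2"
    using theta_lambert_exchange[of 3 4 2] t by (simp add: theta field_simps power2_eq_square)
  have lambert_52: "lambert 5 2 = - t0 * lambert 3 2 / t3 + \<kappa> / t0"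
    using theta_lambert_exchange[of 3 5 2] t by (simp add: theta field_simps power2_eq_square)
  have lambert_62: "lambert 6 2 = t0 * lambert 3 2 / t3"
    using theta_lambert_exchange[of 3 6 2] t by (simp add: theta field_simps power2_eq_square)
  note lambert_2 = lambert_12 lambert_22 lambert_42 lambert_52 lambert_62
  have lambert_13: "lambert 1 3 = \<kappa> / t3"
    using theta_lambert_exchange[of 3 1 3] t by (simp add: theta field_simps power2_eq_square)
  have lambert_23: "lambert 2 3 = t3 * lambert 3 3 / t2 - \<kappa> * t3 / t2^2"
    using theta_lambert_exchange[of 3 2 3] t by (simp add: theta field_simps power2_eq_square)
  have lambert_43: "lambert 4 3 = - t0 * lambert 3 3 / t2 - \<kappa> * t3^2 / (t0^2 * t2)"
    using theta_lambert_exchange[of 3 4 3] t by (simp add: theta field_simps power2_eq_square eq_neg_iff_add_eq_0 neg_eq_iff_add_eq_0)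
  have lambert_53: "lambert 5 3 = t0 * lambert 3 3 / t2"
    using theta_lambert_exchange[of 3 5 3] t by (simp add: theta field_simps power2_eq_square)
  have lambert_63: "lambert 6 3 = - lambert 3 3 + \<kappa> / t2"
    using theta_lambert_exchange[of 3 6 3] t by (simp add: theta field_simps power2_eq_square)
  note lambert_3 = lambert_13 lambert_23 lambert_43 lambert_53 lambert_63
  have lambert_14: "lambert 1 4 = - t3 * lambert 3 4 / t0 + \<kappa> * t2 / (t0 * t3)"
    using theta_lambert_exchange[of 3 1 4] t by (simp add: theta field_simps power2_eq_square)
  have lambert_24: "lambert 2 4 = - t2 * lambert 3 4 / t0 - \<kappa> * t3 / t0^2"
    using theta_lambert_exchange[of 3 2 4] t by (simp add: theta field_simps power2_eq_square eq_neg_iff_add_eq_0)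
  note lambert_4 = lambert_14 lambert_24
  \<comment> \<open>The classes 1 and 4 are known through class 3; their own exchange relation is the new information.\<close>
  have klein: "t0 ^ 3 * t3 + t2 ^ 3 * t0 + t3 ^ 3 * t2 = 0"
  proof -
    have "t3 * lambert 4 2 + t2 * lambert 1 2 = \<kappa> * t0 / t3"
      using theta_lambert_exchange[of 1 4 2] t by (simp add: theta field_simps)
    then have "\<kappa> * (t0 ^ 3 * t3 + t2 ^ 3 * t0 + t3 ^ 3 * t2) = 0"
      unfolding lambert_2 using t by (simp add: field_simps) algebra
    then show ?thesis using \<kappa>0 by simp
  qed
  note alg = seven_algebra[OF ab t klein lambert_pair lambert_2 lambert_3 lambert_4 lambert_refl]
  define R where "R = \<kappa> * (- (t0 / (t3 * t2^2)) + (- a - b) / (t3 * t2) - 1 / (t3 * t0)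
         + a / t2^2 + (1 - a - b) / t0^2) + (b - 1) * lambert 3 4 / t0 - a * lambert 3 3 / t2 - (1 - a - b) * lambert 3 2 / t3"
  have \<Theta>: "(1 + z\<^sup>2) * (1 - inverse (z\<^sup>2)) * \<Theta> = k * - (t0 - b * t2 + a * t3)"
  proof -
    have "\<Theta> = t0 - z\<^sup>2 * t0 + (z\<^sup>2) ^ 2 * t2 + (z\<^sup>2) ^ 3 * t3 - (z\<^sup>2) ^ 5 * t3 - (z\<^sup>2) ^ 6 * t2"
      unfolding \<Theta>_def range by (simp add: theta)
    then show ?thesis unfolding inv\<rho> k_def a_def b_def using z(1,4) by algebra
  qed
  have nz: "k * - (t0 - b * t2 + a * t3) \<noteq> 0"
    using main(3,4) z(5) unfolding \<Theta>[symmetric] by (simp add: mult.assoc)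
  have "RU z q * (k * - (t0 - b * t2 + a * t3)) = k * ((lambert 1 1 + a * lambert 1 2 + b * lambert 1 3 - b * lambert 1 4 - a * lambert 1 5 - lambert 1 6)
     + b * (lambert 2 1 + a * lambert 2 2 + b * lambert 2 3 - b * lambert 2 4 - a * lambert 2 5 - lambert 2 6)
     + (1 - a) * (lambert 3 1 + a * lambert 3 2 + b * lambert 3 3 - b * lambert 3 4 - a * lambert 3 5 - lambert 3 6)
     + b * (lambert 4 1 + a * lambert 4 2 + b * lambert 4 3 - b * lambert 4 4 - a * lambert 4 5 - lambert 4 6)
     + (lambert 5 1 + a * lambert 5 2 + b * lambert 5 3 - b * lambert 5 4 - a * lambert 5 5 - lambert 5 6))"
    unfolding \<Theta>[symmetric] main(1) range by (simp add: w g_def) algebra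
  also have "\<dots> = R * (k * - (t0 - b * t2 + a * t3))"
    unfolding alg R_def[symmetric] by (simp only: mult_ac)
  finally have U: "RU z q = R" using nz by (simp only: mult_cancel_right) simp
  have theta_coeff: "theta_coeff q 0 = 1" "theta_coeff q 2 = q" "theta_coeff q 3 = - (q ^ 3)" "theta_coeff q 4 = q ^ 6" by (simp_all add: theta_coeff_def)
  define J where "J = qpoch_inf (q^49) (q^49)"
  define \<theta>1 \<theta>2 \<theta>3 where "\<theta>1 = qtheta [q^7] (q^49)" and "\<theta>2 = qtheta [q^14] (q^49)" and "\<theta>3 = qtheta [q^21] (q^49)"
  have Q: "Q = q ^ 49" by (simp add: Q_def)
  have pow: "q^49 / q^7 = q^42" "q^49 / q^42 = q^7" "q^49 / q^14 = q^35" "q^49 / q^35 = q^14" "q^49 / q^21 = q^28"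
    by (simp_all add: divide_eq_eq flip: power_add)
  have t0: "t0 = \<theta>3 * J" and t2: "t2 = q * (\<theta>2 * J)" and t3: "t3 = - (q ^ 3 * (\<theta>1 * J))"
    unfolding t0_def t2_def t3_def theta_product theta_coeff Q
    by (simp_all add: \<theta>1_def \<theta>2_def \<theta>3_def J_def qtheta_single pow)
  have \<kappa>: "\<kappa> = q ^ 6 * J ^ 3" by (simp add: \<kappa>_def theta_coeff Q J_def)
  have Sb: "lambert 3 4 = - (q ^ 15 * bilat 49 91 21 q)" "lambert 3 3 = - (q ^ 12 * bilat 49 77 21 q)"
    "lambert 3 2 = - (q ^ 9 * bilat 49 63 21 q)"
    unfolding lambert_eq_bilat theta_coeff by (simp_all flip: power_Suc power_add)
  have nz: "J \<noteq> 0" "\<theta>1 \<noteq> 0" "\<theta>2 \<noteq> 0" "\<theta>3 \<noteq> 0" using t by (auto simp: t0 t2 t3)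
  have prod: "qtheta [q^7, q^14] (q^49) = \<theta>1 * \<theta>2" "qtheta [q^7, q^21] (q^49) = \<theta>1 * \<theta>3"
    by (simp_all add: \<theta>1_def \<theta>2_def \<theta>3_def qtheta_def)
  have coeff: "z + z ^ 6 = a" "z^2 + z^5 = b - 1" "z^3 + z^4 = - a - b" "1 + z^3 + z^4 = 1 - a - b"
    subgoal by (simp add: a_def)
    subgoal by (simp add: b_def)
    subgoal using z(4) unfolding a_def b_def by algebra
    subgoal using z(4) unfolding a_def b_def by algebra
    done
  show ?thesis
    unfolding U R_def t0 t2 t3 \<kappa> Sb prod coeff J_def[symmetric] \<theta>1_def[symmetric] \<theta>2_def[symmetric] \<theta>3_def[symmetric]
    using nz by (simp add: divide_simps) algebra
qed

end

theorem theorem1p2: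
  fixes q \<zeta>\<^sub>3 \<zeta>\<^sub>5 \<zeta>\<^sub>7 :: complex
  assumes "0 < norm q" and "norm q < 1"
    and "primitive_root_of_unity 3 \<zeta>\<^sub>3"
    and "primitive_root_of_unity 5 \<zeta>\<^sub>5"
    and "primitive_root_of_unity 7 \<zeta>\<^sub>7"
  shows
   "(RU \<zeta>\<^sub>3 q =
       q^7 / qpoch_inf (q^3) (q^3) * bilat 9 27 6 q
       - q^5 / qpoch_inf (q^3) (q^3) * bilat 9 21 6 q) \<and>
    (RV \<zeta>\<^sub>3 q =
       - (q^3 / qpoch_inf (q^3) (q^3)) * bilat 9 15 6 q
       + q^5 / qpoch_inf (q^3) (q^3) * bilat 9 21 6 q) \<and>
    (RU \<zeta>\<^sub>5 q =
       q * (qpoch_inf (q^25) (q^25) / (qtheta [q^5] (q^25))\<^sup>2)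
       - q^7 / (qpoch_inf (q^25) (q^25) * qtheta [q^10] (q^25)) * bilat 25 45 10 q
       - q^4 / (qpoch_inf (q^25) (q^25) * qtheta [q^5] (q^25)) * bilat 25 35 10 q) \<and>
    (RV \<zeta>\<^sub>5 q =
       - (q^5 / (qpoch_inf (q^25) (q^25) * qtheta [q^5] (q^25))) * bilat 25 35 15 q
       + q^12 / (qpoch_inf (q^25) (q^25) * qtheta [q^10] (q^25)) * bilat 25 55 15 q
       + q^2 * (qpoch_inf (q^25) (q^25) / qtheta [q^5, q^10] (q^25))
       - q^3 * (qpoch_inf (q^25) (q^25) / (qtheta [q^10] (q^25))\<^sup>2)) \<and>
    (RU \<zeta>\<^sub>7 q =
       q * (qpoch_inf (q^49) (q^49) * qtheta [q^21] (q^49)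
              / (qtheta [q^7] (q^49) * (qtheta [q^14] (q^49))\<^sup>2))
       - (\<zeta>\<^sub>7^2 + \<zeta>\<^sub>7^5) * (q^15 / (qpoch_inf (q^49) (q^49) * qtheta [q^21] (q^49))) * bilat 49 91 21 q
       - (\<zeta>\<^sub>7^3 + \<zeta>\<^sub>7^4) * q^2 * (qpoch_inf (q^49) (q^49) / qtheta [q^7, q^14] (q^49))
       + q^3 * (qpoch_inf (q^49) (q^49) / qtheta [q^7, q^21] (q^49))
       + (\<zeta>\<^sub>7 + \<zeta>\<^sub>7^6) * q^4 * (qpoch_inf (q^49) (q^49) / (qtheta [q^14] (q^49))\<^sup>2)
       + (\<zeta>\<^sub>7 + \<zeta>\<^sub>7^6) * (q^11 / (qpoch_inf (q^49) (q^49) * qtheta [q^14] (q^49))) * bilat 49 77 21 q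
       + (1 + \<zeta>\<^sub>7^3 + \<zeta>\<^sub>7^4) * q^6 * (qpoch_inf (q^49) (q^49) / (qtheta [q^21] (q^49))\<^sup>2)
       - (1 + \<zeta>\<^sub>7^3 + \<zeta>\<^sub>7^4) * (q^6 / (qpoch_inf (q^49) (q^49) * qtheta [q^7] (q^49))) * bilat 49 63 21 q)"
proof -
  interpret nome q by unfold_locales (use assms(1,2) in auto)
  show ?thesis
    using dissection_3[OF assms(3)] dissection_5[OF assms(4)] dissection_7[OF assms(5)]
    by (intro conjI)
qed

end
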